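(* Let $d\geq1$, let $(\Phi,\Phi_* )$ be an admissible pair of complementary Young functions with associated quantities $\tilde m,\tilde M$, put $p:=\tilde M+1$, let $A,B\colon\mathbb{R}^d\to\mathbb{C}^{d\times d}$ be $p$-elliptic matrix functions with $\mathrm{L}^\infty$ coefficients, and let $\mathfrak{X}\colon\mathbb{C}^2\to[0,\infty)$ be the associated Bellman function. Then for almost every $x\in\mathbb{R}^d$, all $(u,v)\in(\mathbb{C}\setminus\{0\})^2\setminus\mathcal{Y}$ and all $(\zeta,\eta)\in(\mathbb{C}^d)^2$, $$H^{A(x),B(x)}_{\mathfrak{X}}[(u,v);(\zeta,\eta)]\ \geq\ \frac1{10}\Big(\frac{\tilde M}{\tilde m}\,\frac{\tilde m-1}{\tilde M-1}\Big)^{1/2}C_p(A,B)^{-1}\,|\zeta|\,|\eta|,$$ where $$C_p(A,B):=\frac{\max\{\Lambda(A),\Lambda(B)\}}{\min\{\Delta_p(A),\Delta_p(B)\}\,\min\{\lambda(A),\lambda(B)\}}.$$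
   Context: **Young functions.** A Young function is a convex function $\Phi\colon[0,\infty)\to[0,\infty)$ with $\Phi(0)=0$, $\lim_{s\to0^+}\Phi(s)/s=0$ and $\lim_{s\to\infty}\Phi(s)/s=\infty$. Its complementary Young function is $\Phi_*(t):=\sup_{s>0}(st-\Phi(s))$, $t\in[0,\infty)$. A pair $(\Phi,\Phi_* )$ is called admissible if: $\Phi$ and $\Phi_*$ are mutually complementary Young functions; both are $\mathrm{C}^1$ on $[0,\infty)$ and $\mathrm{C}^2$ on $(0,\infty)$; $\Phi''(s)>0$ and $\Phi_*''(s)>0$ for $s\in(0,\infty)$; $\Phi'$ is strictly convex on $(0,\infty)$ and $\lim_{s\to0^+}\Phi'(s)/s=0$; $\sup_{s>0}\frac{s\Phi'(s)}{\Phi(s)}<\infty$; and $1<\inf_{s>0}\frac{s\Phi''(s)}{\Phi'(s)}\leq\sup_{s>0}\frac{s\Phi''(s)}{\Phi'(s)}<\infty$. Put $\tilde m:=\inf_{s>0}\frac{s\Phi''(s)}{\Phi'(s)}$, $\tilde M:=\sup_{s>0}\frac{s\Phi''(s)}{\Phi'(s)}$. For an admissible pair, $\Phi'$ and $\Phi_*'$ are mutually inverse increasing bijections of $[0,\infty)$. **Matrix functions.** $\langle\cdot,\cdot\rangle_{\mathbb{C}^d}$ is the standard inner product, linear in the first and antilinear in the second argument, and $|\cdot|$ is the Euclidean norm. For $A\colon\mathbb{R}^d\to\mathbb{C}^{d\times d}$ with $\mathrm{L}^\infty$ entries, $$\Lambda(A):=\operatorname*{ess\,sup}_{x}\max_{|\zeta|=|\eta|=1}|\langle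 A(x)\zeta,\eta\rangle_{\mathbb{C}^d}|,\quad \lambda(A):=\operatorname*{ess\,inf}_{x}\min_{|\xi|=1}\operatorname{Re}\langle A(x)\xi,\xi\rangle_{\mathbb{C}^d},$$ $$\Delta_p(A):=\operatorname*{ess\,inf}_{x}\min_{|\xi|=1}\operatorname{Re}\Big\langle A(x)\xi,\ \xi+\Big|1-\frac2p\Big|\bar\xi\Big\rangle_{\mathbb{C}^d},$$ with $\zeta,\eta,\xi\in\mathbb{C}^d$. $A$ is elliptic if $\Lambda(A)<\infty$ and $\lambda(A)>0$; it is $p$-elliptic if, in addition, $\Delta_p(A)>0$. **Bellman function.** Let $\mathcal{Y}:=\{(u,v)\in\mathbb{C}^2:|v|=\Phi'(|u|)\}$, $\mathcal{Y}_\downarrow:=\{(u,v)\in\mathbb{C}^2:|v|<\Phi'(|u|)\}$, $\mathcal{Y}_\uparrow:=\{(u,v)\in\mathbb{C}^2:|v|>\Phi'(|u|)\}$. With $p=\tilde M+1$ let $$\delta:=\frac{\tilde m-1}{\tilde m}\min\Big\{\frac{\Delta_p(A)}{8\Lambda(A)},\ \frac{\Delta_p(B)}{4\Lambda(B)},\ \frac{\lambda(A)\Delta_p(B)}{100\max\{\Lambda(A)^2,\Lambda(B)^2\}}\Big\}.$$ The associated Bellman function is $\mathfrak{X}\colon\mathbb{C}^2\to[0,\infty)$, $$\mathfrak{X}(u,v):=\begin{cases}(1+\delta)\big(\Phi(|u|)+\Phi_*(|v|)\big)+\delta|u|^2\displaystyle\int_0^{|u|}\frac{\Phi'(s)\,\mathrm{d}s}{s^2},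 & (u,v)\in\mathcal{Y}_\downarrow\cup\mathcal{Y},\\[2mm] \Phi(|u|)+\Phi_*(|v|)+\delta|u|^2\displaystyle\int_0^{|v|}\frac{\mathrm{d}s}{\Phi_*'(s)}, & (u,v)\in\mathcal{Y}_\uparrow\end{cases}$$ (the integrals converge under the standing assumptions). It is $\mathrm{C}^2$ on $(\mathbb{C}\setminus\{0\})^2\setminus\mathcal{Y}$. **Generalized Hessian.** Let $\mathfrak{X}$ be a real function on $\mathbb{C}^2$ which is $\mathrm{C}^2$ near $(u,v)$, and let $\operatorname{Hess}(\mathfrak{X};(u,v))$ be the $4\times4$ real Hessian at $(u,v)$ of $(u_r,u_i,v_r,v_i)\mapsto\mathfrak{X}(u_r+iu_i,v_r+iv_i)$. For $A,B\in\mathbb{C}^{d\times d}$ and $\zeta,\eta\in\mathbb{C}^d$, $H^{A,B}_{\mathfrak{X}}[(u,v);(\zeta,\eta)]$ is the standard inner product in $(\mathbb{R}^d)^4$ of $(\operatorname{Hess}(\mathfrak{X};(u,v))\otimes I_d)\,w$ and $\mathcal{M}w$, where $\otimes$ is the Kronecker product, $w=(\operatorname{Re}\zeta,\operatorname{Im}\zeta,\operatorname{Re}\eta,\operatorname{Im}\eta)^{\mathrm T}\in(\mathbb{R}^d)^4$, and $$\mathcal{M}=\begin{bmatrix}\operatorname{Re}A&-\operatorname{Im}A&0&0\\ \operatorname{Im}A&\operatorname{Re}A&0&0\\0&0&\operatorname{Re}B&-\operatorname{Im}B\\0&0&\operatorname{Im}B&\operatorname{Re}B\end{bmatrix}.$$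 *)

theory Defs
  imports "HOL-Analysis.Analysis" "HOL-Probability.Essential_Supremum"
begin

section \<open>Young functions\<close>

text \<open>
  Functions on \<open>[0,\<infinity>)\<close> are represented by total functions on the reals whose values at negative
  arguments are irrelevant. Accordingly, \<open>hderiv\<close> is the derivative relative to the half-line: it is
  one-sided at \<open>0\<close> and the ordinary derivative on \<open>(0,\<infinity>)\<close>.
\<close>

definition hderiv :: "(real \<Rightarrow> real) \<Rightarrow> real \<Rightarrow> real" where
  "hderiv f s = vector_derivative f (at s within {0..})"

definition strictly_convex_on :: "'a::real_vector set \<Rightarrow> ('a \<Rightarrow> real) \<Rightarrow> bool" where
  "strictly_convex_on S f \<longleftrightarrow> convex S \<and>
    (\<forall>x\<in>S. \<forall>y\<in>S. \<forall>u>0. \<forall>v>0. x \<noteq> y \<and> u + v = 1 \<longrightarrow>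
       f (u *\<^sub>R x + v *\<^sub>R y) < u * f x + v * f y)"

definition young_function :: "(real \<Rightarrow> real) \<Rightarrow> bool" where
  "young_function \<Phi> \<longleftrightarrow>
    convex_on {0..} \<Phi> \<and> (\<forall>s\<ge>0. \<Phi> s \<ge> 0) \<and> \<Phi> 0 = 0 \<and>
    ((\<lambda>s. \<Phi> s / s) \<longlongrightarrow> 0) (at_right 0) \<and>
    filterlim (\<lambda>s. \<Phi> s / s) at_top at_top"

text \<open>
  For a Young function the supremum is over a nonempty set that is bounded above, since
  \<open>\<Phi> s / s\<close> tends to infinity, so the supremum of reals is the genuine one.
\<close>

definition complementary_young :: "(real \<Rightarrow> real) \<Rightarrow> real \<Rightarrow> real" where
  "complementary_young \<Phi> t = (SUP s\<in>{0<..}. s * t - \<Phi> s)"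

definition C1_C2_halfline :: "(real \<Rightarrow> real) \<Rightarrow> bool" where
  "C1_C2_halfline f \<longleftrightarrow>
    f differentiable_on {0..} \<and> continuous_on {0..} (hderiv f) \<and>
    hderiv f differentiable_on {0<..} \<and> continuous_on {0<..} (hderiv (hderiv f))"

definition m_tilde :: "(real \<Rightarrow> real) \<Rightarrow> real" where
  "m_tilde \<Phi> = (INF s\<in>{0<..}. s * hderiv (hderiv \<Phi>) s / hderiv \<Phi> s)"

definition M_tilde :: "(real \<Rightarrow> real) \<Rightarrow> real" where
  "M_tilde \<Phi> = (SUP s\<in>{0<..}. s * hderiv (hderiv \<Phi>) s / hderiv \<Phi> s)"

text \<open>
  The second argument plays the role of the complementary function \<open>\<Phi>\<^sub>*\<close>. Boundedness below of the
  quotient defining \<open>m_tilde\<close> is automatic, as the quotient is positive under the other clauses.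
\<close>

definition admissible_pair :: "(real \<Rightarrow> real) \<Rightarrow> (real \<Rightarrow> real) \<Rightarrow> bool" where
  "admissible_pair \<Phi> \<Psi> \<longleftrightarrow>
    young_function \<Phi> \<and> young_function \<Psi> \<and>
    (\<forall>t\<ge>0. \<Psi> t = complementary_young \<Phi> t) \<and>
    (\<forall>s\<ge>0. \<Phi> s = complementary_young \<Psi> s) \<and>
    C1_C2_halfline \<Phi> \<and> C1_C2_halfline \<Psi> \<and>
    (\<forall>s>0. hderiv (hderiv \<Phi>) s > 0) \<and> (\<forall>s>0. hderiv (hderiv \<Psi>) s > 0) \<and>
    strictly_convex_on {0<..} (hderiv \<Phi>) \<and>
    ((\<lambda>s. hderiv \<Phi> s / s) \<longlongrightarrow> 0) (at_right 0) \<and>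
    bdd_above ((\<lambda>s. s * hderiv \<Phi> s / \<Phi> s) ` {0<..}) \<and>
    1 < m_tilde \<Phi> \<and>
    bdd_above ((\<lambda>s. s * hderiv (hderiv \<Phi>) s / hderiv \<Phi> s) ` {0<..})"


section \<open>Matrix functions\<close>

text \<open>Linear in the first argument and antilinear in the second.\<close>

definition cinner :: "complex^'n \<Rightarrow> complex^'n \<Rightarrow> complex" where
  "cinner x y = (\<Sum>i\<in>UNIV. x $ i * cnj (y $ i))"

definition vec_cnj :: "complex^'n \<Rightarrow> complex^'n" where
  "vec_cnj x = (\<chi> i. cnj (x $ i))"

definition essinf :: "'a measure \<Rightarrow> ('a \<Rightarrow> ereal) \<Rightarrow> ereal" where
  "essinf M f = - esssup M (\<lambda>x. - f x)"

definition Linf_matrix :: "(real^'n \<Rightarrow> complex^'n^'n) \<Rightarrow> bool" where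
  "Linf_matrix A \<longleftrightarrow>
    (\<forall>i j. (\<lambda>x. A x $ i $ j) \<in> borel_measurable lebesgue \<and>
           esssup lebesgue (\<lambda>x. ereal (cmod (A x $ i $ j))) < \<infinity>)"

text \<open>
  The inner suprema and infima are those of continuous functions over compact unit spheres, hence
  maxima and minima.
\<close>

definition Lambda_ess :: "(real^'n \<Rightarrow> complex^'n^'n) \<Rightarrow> ereal" where
  "Lambda_ess A = esssup lebesgue
    (\<lambda>x. ereal (SUP (\<zeta>,\<eta>)\<in>sphere 0 1 \<times> sphere 0 1. cmod (cinner (A x *v \<zeta>) \<eta>)))"

definition lambda_ess :: "(real^'n \<Rightarrow> complex^'n^'n) \<Rightarrow> ereal" where
  "lambda_ess A = essinf lebesgue
    (\<lambda>x. ereal (INF \<xi>\<in>sphere 0 1. Re (cinner (A x *v \<xi>) \<xi>)))"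

definition Delta_ess :: "real \<Rightarrow> (real^'n \<Rightarrow> complex^'n^'n) \<Rightarrow> ereal" where
  "Delta_ess p A = essinf lebesgue
    (\<lambda>x. ereal (INF \<xi>\<in>sphere 0 1.
       Re (cinner (A x *v \<xi>) (\<xi> + \<bar>1 - 2 / p\<bar> *\<^sub>R vec_cnj \<xi>))))"

definition elliptic :: "(real^'n \<Rightarrow> complex^'n^'n) \<Rightarrow> bool" where
  "elliptic A \<longleftrightarrow> Lambda_ess A < \<infinity> \<and> lambda_ess A > 0"

definition p_elliptic :: "real \<Rightarrow> (real^'n \<Rightarrow> complex^'n^'n) \<Rightarrow> bool" where
  "p_elliptic p A \<longleftrightarrow> elliptic A \<and> Delta_ess p A > 0"

text \<open>For essentially bounded matrix functions all three quantities are finite.\<close>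

abbreviation Lambda_real :: "(real^'n \<Rightarrow> complex^'n^'n) \<Rightarrow> real" where
  "Lambda_real A \<equiv> real_of_ereal (Lambda_ess A)"

abbreviation lambda_real :: "(real^'n \<Rightarrow> complex^'n^'n) \<Rightarrow> real" where
  "lambda_real A \<equiv> real_of_ereal (lambda_ess A)"

abbreviation Delta_real :: "real \<Rightarrow> (real^'n \<Rightarrow> complex^'n^'n) \<Rightarrow> real" where
  "Delta_real p A \<equiv> real_of_ereal (Delta_ess p A)"

definition C_const :: "real \<Rightarrow> (real^'n \<Rightarrow> complex^'n^'n) \<Rightarrow> (real^'n \<Rightarrow> complex^'n^'n) \<Rightarrow> real" where
  "C_const p A B =
    max (Lambda_real A) (Lambda_real B) /
    (min (Delta_real p A) (Delta_real p B) * min (lambda_real A) (lambda_real B))"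


section \<open>The Bellman function\<close>

definition Y_eq :: "(real \<Rightarrow> real) \<Rightarrow> (complex \<times> complex) set" where
  "Y_eq \<Phi> = {(u, v). cmod v = hderiv \<Phi> (cmod u)}"

definition Y_down :: "(real \<Rightarrow> real) \<Rightarrow> (complex \<times> complex) set" where
  "Y_down \<Phi> = {(u, v). cmod v < hderiv \<Phi> (cmod u)}"

definition Y_up :: "(real \<Rightarrow> real) \<Rightarrow> (complex \<times> complex) set" where
  "Y_up \<Phi> = {(u, v). cmod v > hderiv \<Phi> (cmod u)}"

definition bellman_delta ::
    "(real \<Rightarrow> real) \<Rightarrow> (real^'n \<Rightarrow> complex^'n^'n) \<Rightarrow> (real^'n \<Rightarrow> complex^'n^'n) \<Rightarrow> real" where
  "bellman_delta \<Phi> A B =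
    (let p = M_tilde \<Phi> + 1 in
      (m_tilde \<Phi> - 1) / m_tilde \<Phi> *
      Min {Delta_real p A / (8 * Lambda_real A),
           Delta_real p B / (4 * Lambda_real B),
           lambda_real A * Delta_real p B / (100 * max ((Lambda_real A)\<^sup>2) ((Lambda_real B)\<^sup>2))})"

text \<open>
  Complementary to \<open>Y_down \<Phi> \<union> Y_eq \<Phi>\<close> is \<open>Y_up \<Phi>\<close>. The value of the integrands at \<open>s = 0\<close>
  (where Isabelle's division by zero yields \<open>0\<close>) does not affect the integrals.
\<close>

definition bellman ::
    "(real \<Rightarrow> real) \<Rightarrow> (real \<Rightarrow> real) \<Rightarrow> (real^'n \<Rightarrow> complex^'n^'n) \<Rightarrow> (real^'n \<Rightarrow> complex^'n^'n)
      \<Rightarrow> complex \<Rightarrow> complex \<Rightarrow> real" where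
  "bellman \<Phi> \<Psi> A B u v =
    (let \<delta> = bellman_delta \<Phi> A B in
      if (u, v) \<in> Y_down \<Phi> \<union> Y_eq \<Phi>
      then (1 + \<delta>) * (\<Phi> (cmod u) + \<Psi> (cmod v))
             + \<delta> * (cmod u)\<^sup>2 * integral {0..cmod u} (\<lambda>s. hderiv \<Phi> s / s\<^sup>2)
      else \<Phi> (cmod u) + \<Psi> (cmod v)
             + \<delta> * (cmod u)\<^sup>2 * integral {0..cmod v} (\<lambda>s. 1 / hderiv \<Psi> s))"


section \<open>The generalized Hessian\<close>

definition partial_deriv :: "'m \<Rightarrow> (real^'m \<Rightarrow> real) \<Rightarrow> real^'m \<Rightarrow> real" where
  "partial_deriv i g x = deriv (\<lambda>t. g (x + t *\<^sub>R axis i 1)) 0"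

definition hessian :: "(real^'m \<Rightarrow> real) \<Rightarrow> real^'m \<Rightarrow> real^'m^'m" where
  "hessian g x = (\<chi> i j. partial_deriv i (partial_deriv j g) x)"

definition Hess :: "(complex \<Rightarrow> complex \<Rightarrow> real) \<Rightarrow> complex \<Rightarrow> complex \<Rightarrow> real^4^4" where
  "Hess F u v =
    hessian (\<lambda>x :: real^4. F (Complex (x $ 1) (x $ 2)) (Complex (x $ 3) (x $ 4)))
      (vector [Re u, Im u, Re v, Im v])"

text \<open>
  The index type of a Kronecker product is the product of the index types; thus \<open>(\<real>\<^sup>d)\<^sup>4\<close> is
  \<open>real ^ (4 \<times> 'n)\<close>, the first index component selecting the block.
\<close>

definition kronecker :: "real^'b^'a \<Rightarrow> real^'d^'c \<Rightarrow> real^('b \<times> 'd)^('a \<times> 'c)" where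
  "kronecker P Q = (\<chi> a b. P $ fst a $ fst b * Q $ snd a $ snd b)"

definition Re_vec :: "complex^'n \<Rightarrow> real^'n" where
  "Re_vec z = (\<chi> i. Re (z $ i))"

definition Im_vec :: "complex^'n \<Rightarrow> real^'n" where
  "Im_vec z = (\<chi> i. Im (z $ i))"

definition Re_mat :: "complex^'n^'n \<Rightarrow> real^'n^'n" where
  "Re_mat A = (\<chi> i j. Re (A $ i $ j))"

definition Im_mat :: "complex^'n^'n \<Rightarrow> real^'n^'n" where
  "Im_mat A = (\<chi> i j. Im (A $ i $ j))"

definition w_vec :: "complex^'n \<Rightarrow> complex^'n \<Rightarrow> real^(4 \<times> 'n)" where
  "w_vec \<zeta> \<eta> =
    (\<chi> a. (vector [Re_vec \<zeta>, Im_vec \<zeta>, Re_vec \<eta>, Im_vec \<eta>] :: real^'n^4) $ fst a $ snd a)"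

definition M_mat :: "complex^'n^'n \<Rightarrow> complex^'n^'n \<Rightarrow> real^(4 \<times> 'n)^(4 \<times> 'n)" where
  "M_mat A B =
    (\<chi> a b. (vector
       [vector [Re_mat A, - Im_mat A, 0,        0         ],
        vector [Im_mat A, Re_mat A,   0,        0         ],
        vector [0,        0,          Re_mat B, - Im_mat B],
        vector [0,        0,          Im_mat B, Re_mat B  ]] :: real^'n^'n^4^4)
       $ fst a $ fst b $ snd a $ snd b)"

definition gen_hessian ::
    "complex^'n^'n \<Rightarrow> complex^'n^'n \<Rightarrow> (complex \<Rightarrow> complex \<Rightarrow> real) \<Rightarrow> complex \<Rightarrow> complex
      \<Rightarrow> complex^'n \<Rightarrow> complex^'n \<Rightarrow> real" where
  "gen_hessian A B F u v \<zeta> \<eta> =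
    (kronecker (Hess F u v) (mat 1) *v w_vec \<zeta> \<eta>) \<bullet> (M_mat A B *v w_vec \<zeta> \<eta>)"

end

theory Submission
  imports Defs
begin

text \<open>
  The Bellman function is biradial: off the interface it has the form
  \<open>a (cmod u) + b (cmod v) + c * (cmod u)\<^sup>2 * g (cmod v)\<close>. After rotating \<open>\<zeta>\<close> and \<open>\<eta>\<close> by the phases of
  \<open>u\<close> and \<open>v\<close>, the Hessian of such a function is diagonal apart from a single coupling of the two
  radial directions, so the generalized Hessian is a sum of quadratic forms
  \<open>Re \<langle>A \<xi>, (a'' + a'/r)/2 \<cdot> \<xi> + (a'' - a'/r)/2 \<cdot> cnj \<xi>\<rangle>\<close> and one cross term
  (lemma \<open>gen_hessian_biradial\<close>). Such a form is at least \<open>\<Delta>\<^sub>p(A) \<cdot> (a'' + a'/r)/2 \<cdot> |\<xi>|\<^sup>2\<close>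
  as soon as \<open>|a'' - a'/r| \<le> |1 - 2/p| \<cdot> (a'' + a'/r)\<close> (lemma \<open>polar_form_lower_bound\<close>), and for
  \<open>p = M + 1\<close>, with \<open>M\<close> the upper index of \<open>\<Phi>\<close>, that condition says exactly that \<open>r * a'' / a'\<close> lies
  between \<open>1 / M\<close> and \<open>M\<close>. It holds for \<open>\<Phi>\<close>, for its complementary function, and for the extra
  summand \<open>r\<^sup>2 \<cdot> \<integral>\<^sub>0\<^sup>r \<Phi>'(s)/s\<^sup>2 ds\<close>; the last one needs the sharp lower bound
  \<open>\<Phi>'(r)/r \<le> (M - 1) \<cdot> \<integral>\<^sub>0\<^sup>r \<Phi>'(s)/s\<^sup>2 ds\<close>.

  Below the interface the function is a sum of a function of \<open>u\<close> and a function of \<open>v\<close>. The form in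
  \<open>\<zeta>\<close> carries the weight \<open>\<Phi>'(|u|)/|u|\<close> and the form in \<open>\<eta>\<close> the weight \<open>\<Psi>'(|v|)/|v|\<close>, up to
  constants. Because \<open>\<Phi>'(s)/s\<close> increases and \<open>\<Psi>'\<close> is the inverse of \<open>\<Phi>'\<close>, the product of the two
  weights is at least \<open>1\<close> there, and the inequality of the means gives the bilinear bound.

  Above the interface only the summand with factor \<open>\<delta>\<close> makes the form in \<open>\<zeta>\<close> large: it contributes
  \<open>2\<delta> \<lambda>(A) \<cdot> g(|v|) \<cdot> |\<zeta>|\<^sup>2\<close>, where \<open>g(t) \<ge> M/(M - 1) \<cdot> t/\<Psi>'(t)\<close>. The weight of \<open>|\<eta>|\<^sup>2\<close> is
  \<open>\<Psi>'(|v|)/|v|\<close>, the reciprocal of \<open>t/\<Psi>'(t)\<close> at \<open>t = |v|\<close>, so the inequality of the means again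
  produces a constant multiple of \<open>|\<zeta>| |\<eta>|\<close>. What \<open>\<delta>\<close> spoils, namely the form of \<open>g\<close> in \<open>\<eta>\<close> and the cross
  term, is of higher order in \<open>\<delta>\<close>; the last two entries of the minimum defining \<open>\<delta>\<close> make it a fixed
  fraction of what is gained (lemma \<open>bellman_constant_bounds\<close>).
\<close>

section \<open>Quadratic forms of complex matrices\<close>

text \<open>
  Real parts of complex pairings are the Euclidean inner product of \<open>complex^'n\<close> as a real vector
  space, so everything below is phrased with \<open>\<bullet>\<close>.
\<close>

lemma Re_cinner: "Re (cinner x y) = x \<bullet> y"
  by (simp add: cinner_def inner_vec_def inner_complex_def)

text \<open>
  For unimodular \<open>s\<close> this is conjugation in coordinates rotated by the phase \<open>s\<close>, that is, the
  reflection that in every coordinate fixes the real multiples of \<open>s\<close> and negates those of \<open>\<i> * s\<close>.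
\<close>

definition twisted_cnj :: "complex \<Rightarrow> complex^'n \<Rightarrow> complex^'n" where
  "twisted_cnj s z = s\<^sup>2 *s vec_cnj z"

text \<open>
  The contribution of a radial function \<open>f (cmod u)\<close> to the generalized Hessian, with \<open>s = sgn u\<close>: the
  number \<open>a\<close> is the second derivative of \<open>f\<close> along the radius and \<open>b = f' / r\<close> the one across it.
\<close>

definition polar_form :: "real \<Rightarrow> real \<Rightarrow> complex \<Rightarrow> complex^'n^'n \<Rightarrow> complex^'n \<Rightarrow> real" where
  "polar_form a b s M z =
    (a + b) / 2 * ((M *v z) \<bullet> z) + (a - b) / 2 * ((M *v z) \<bullet> twisted_cnj s z)"

lemma norm_vec_cnj [simp]: "norm (vec_cnj z) = norm z"
  by (simp add: vec_cnj_def norm_vec_def)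

lemma norm_twisted_cnj:
  assumes "cmod s = 1"
  shows "norm (twisted_cnj s z) = norm z"
  using assms
  by (simp add: twisted_cnj_def vec_cnj_def norm_vec_def norm_mult norm_power)

text \<open>
  The left-hand side is what differentiating a radial gradient field produces. The identity rests on
  \<open>Re x * Re y = (Re (x * cnj y) + Re (x * y)) / 2\<close> for the rotated entries.
\<close>

lemma polar_form_eq_sum:
  assumes "cmod s = 1"
  shows "(\<Sum>k\<in>UNIV. b * ((M *v z) $ k \<bullet> z $ k) + (a - b) * (s \<bullet> (M *v z) $ k) * (s \<bullet> z $ k))
    = polar_form a b s M z"
proof -
  have s: "Re s * Re s = 1 - Im s * Im s"
    using assms by (simp add: cmod_def power2_eq_square)
  have *: "(s \<bullet> x) * (s \<bullet> y) = (x \<bullet> y) / 2 + (x \<bullet> (s\<^sup>2 * cnj y)) / 2" for x y :: complex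
  proof -
    have "2 * ((s \<bullet> x) * (s \<bullet> y)) = (Re s * Re s + Im s * Im s) * (x \<bullet> y) + x \<bullet> (s\<^sup>2 * cnj y)"
      by (simp add: inner_complex_def power2_eq_square algebra_simps)
    then show ?thesis by (simp add: s)
  qed
  have "b * (x \<bullet> y) + (a - b) * (s \<bullet> x) * (s \<bullet> y)
      = (a + b) / 2 * (x \<bullet> y) + (a - b) / 2 * (x \<bullet> (s\<^sup>2 * cnj y))" for x y :: complex
    unfolding mult.assoc * by (simp add: field_simps)
  then show ?thesis
    by (simp add: polar_form_def inner_vec_def twisted_cnj_def vec_cnj_def sum.distrib sum_distrib_left)
qed

text \<open>
  The hypothesis on the matrix, used for \<open>\<xi>\<close> and for \<open>\<i> * \<xi>\<close>, bounds the form from below with both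
  signs of \<open>\<sigma>\<close>; by convexity it then holds for every real coefficient of the conjugate part
  between \<open>- \<sigma>\<close> and \<open>\<sigma>\<close>.
\<close>

lemma polar_form_lower_bound:
  fixes M :: "complex^'n^'n"
  assumes ell: "\<And>\<xi>. \<Delta> * (norm \<xi>)\<^sup>2 \<le> (M *v \<xi>) \<bullet> (\<xi> + \<sigma> *\<^sub>R vec_cnj \<xi>)"
    and s: "cmod s = 1" and ab: "0 \<le> a + b" "\<bar>a - b\<bar> \<le> \<sigma> * (a + b)"
  shows "\<Delta> * ((a + b) / 2) * (norm z)\<^sup>2 \<le> polar_form a b s M z"
proof -
  define X where "X = (M *v z) \<bullet> z"
  define Y where "Y = (M *v z) \<bullet> twisted_cnj s z"
  have ss: "s * cnj s = 1"
    using s by (simp add: complex_norm_square[symmetric])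
  \<comment> \<open>The choices \<open>e = 1\<close> and \<open>e = \<i>\<close> give the two signs of \<open>\<sigma>\<close>.\<close>
  have rotate: "\<Delta> * (norm z)\<^sup>2 \<le> X + \<sigma> * Re (e\<^sup>2) * Y"
    if e: "cmod e = 1" "Im (e\<^sup>2) = 0" for e
  proof -
    define c where "c = e * cnj s"
    have c: "cmod c = 1" using e s by (simp add: c_def norm_mult)
    have cc: "Re c * Re c = 1 - Im c * Im c"
      using c by (simp add: cmod_def power2_eq_square)
    have e2: "e\<^sup>2 = of_real (Re (e\<^sup>2))" using e by (simp add: complex_eq_iff)
    have 1: "(M *v (c *s z)) \<bullet> (c *s z) = X"
    proof -
      have "(c * x) \<bullet> (c * y) = (Re c * Re c + Im c * Im c) * (x \<bullet> y)" for x y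
        by (simp add: inner_complex_def algebra_simps)
      then have "(c * x) \<bullet> (c * y) = x \<bullet> y" for x y by (simp add: cc)
      then show ?thesis
        by (simp add: X_def vector_scalar_commute inner_vec_def)
    qed
    have 2: "(M *v (c *s z)) \<bullet> vec_cnj (c *s z) = Re (e\<^sup>2) * Y"
    proof -
      have "(c * x) \<bullet> cnj (c * y) = Re (e\<^sup>2) * (x \<bullet> (s\<^sup>2 * cnj y))" for x y
      proof -
        have "(c * x) \<bullet> cnj (c * y) = Re (c\<^sup>2 * (x * y))"
          by (simp add: inner_complex_def power2_eq_square algebra_simps)
        also have "\<dots> = Re (e\<^sup>2 * (cnj s ^ 2 * (x * y)))"
          by (simp add: c_def power_mult_distrib mult_ac)
        also have "\<dots> = Re (e\<^sup>2) * Re (cnj s ^ 2 * (x * y))"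
          by (subst e2) simp
        also have "Re (cnj s ^ 2 * (x * y)) = x \<bullet> (s\<^sup>2 * cnj y)"
          by (simp add: inner_complex_def power2_eq_square algebra_simps)
        finally show ?thesis .
      qed
      then show ?thesis
        by (simp add: Y_def vector_scalar_commute inner_vec_def vec_cnj_def twisted_cnj_def
            sum_distrib_left)
    qed
    have "norm (c *s z) = norm z" using c by (simp add: norm_vec_def norm_mult)
    with ell[of "c *s z"] show ?thesis
      by (simp add: inner_add_right 1 2 mult.assoc)
  qed
  have "\<Delta> * (norm z)\<^sup>2 \<le> X - \<sigma> * \<bar>Y\<bar>"
  proof (cases "Y \<ge> 0")
    case True
    with rotate[of \<i>] show ?thesis by simp
  next
    case False
    with rotate[of 1] show ?thesis by simp
  qed
  then have "(a + b) / 2 * (\<Delta> * (norm z)\<^sup>2) \<le> (a + b) / 2 * (X - \<sigma> * \<bar>Y\<bar>)"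
    by (rule mult_left_mono) (use ab in simp)
  also have "\<dots> = (a + b) / 2 * X - \<sigma> * (a + b) * \<bar>Y\<bar> / 2" by (simp add: field_simps)
  also have "\<dots> \<le> (a + b) / 2 * X - \<bar>a - b\<bar> * \<bar>Y\<bar> / 2"
    using mult_right_mono[OF ab(2), of "\<bar>Y\<bar>"] by simp
  also have "\<dots> \<le> (a + b) / 2 * X + (a - b) / 2 * Y"
  proof -
    have "- ((a - b) * Y) \<le> \<bar>a - b\<bar> * \<bar>Y\<bar>"
      by (metis abs_ge_minus_self abs_mult)
    then show ?thesis by simp
  qed
  finally show ?thesis by (simp add: polar_form_def X_def Y_def mult_ac)
qed

lemma abs_polar_form_le:
  fixes M :: "complex^'n^'n"
  assumes bd: "\<And>\<xi> \<omega>. \<bar>(M *v \<xi>) \<bullet> \<omega>\<bar> \<le> L * norm \<xi> * norm \<omega>" and s: "cmod s = 1" and "L \<ge> 0"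
  shows "\<bar>polar_form a b s M z\<bar> \<le> L * (\<bar>a\<bar> + \<bar>b\<bar>) * (norm z)\<^sup>2"
proof -
  define X where "X = (M *v z) \<bullet> z"
  define Y where "Y = (M *v z) \<bullet> twisted_cnj s z"
  have X: "\<bar>X\<bar> \<le> L * (norm z)\<^sup>2" and Y: "\<bar>Y\<bar> \<le> L * (norm z)\<^sup>2"
    using bd[of z z] bd[of z "twisted_cnj s z"] s
    by (simp_all add: X_def Y_def norm_twisted_cnj power2_eq_square mult_ac)
  have "polar_form a b s M z = a * ((X + Y) / 2) + b * ((X - Y) / 2)"
    by (simp add: polar_form_def X_def Y_def field_simps)
  also have "\<bar>\<dots>\<bar> \<le> \<bar>a\<bar> * \<bar>(X + Y) / 2\<bar> + \<bar>b\<bar> * \<bar>(X - Y) / 2\<bar>"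
    by (metis abs_mult abs_triangle_ineq)
  also have "\<dots> \<le> \<bar>a\<bar> * (L * (norm z)\<^sup>2) + \<bar>b\<bar> * (L * (norm z)\<^sup>2)"
    using X Y by (intro add_mono mult_left_mono) auto
  finally show ?thesis by (simp add: algebra_simps)
qed

lemma abs_cross_term_le:
  fixes M :: "complex^'n^'n"
  assumes bd: "\<And>\<xi> \<omega>. \<bar>(M *v \<xi>) \<bullet> \<omega>\<bar> \<le> L * norm \<xi> * norm \<omega>" and "cmod s = 1" "cmod s' = 1"
    and "L \<ge> 0"
  shows "\<bar>\<Sum>k\<in>UNIV. (s \<bullet> (M *v \<eta>) $ k) * (s' \<bullet> \<zeta> $ k)\<bar> \<le> L * norm \<eta> * norm \<zeta>"
proof -
  define y :: "complex^'n" where "y = (\<chi> k. (s' \<bullet> \<zeta> $ k) *\<^sub>R s)"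
  have "norm y \<le> norm \<zeta>"
  proof (rule norm_le_componentwise_cart)
    fix k
    show "norm (y $ k) \<le> norm (\<zeta> $ k)"
      using Cauchy_Schwarz_ineq2[of s' "\<zeta> $ k"] assms by (simp add: y_def)
  qed
  moreover have "(\<Sum>k\<in>UNIV. (s \<bullet> (M *v \<eta>) $ k) * (s' \<bullet> \<zeta> $ k)) = (M *v \<eta>) \<bullet> y"
    by (simp add: y_def inner_vec_def inner_commute mult_ac)
  ultimately show ?thesis
    using bd[of \<eta> y] assms
    by (metis (no_types, lifting) mult_left_mono norm_ge_zero order_trans mult_nonneg_nonneg)
qed

section \<open>The generalized Hessian of a biradial function\<close>

lemma vector_4 [simp]:
  "(vector [x, y, z, w] :: 'a::zero^4) $ 1 = x"
  "(vector [x, y, z, w] :: 'a::zero^4) $ 2 = y"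
  "(vector [x, y, z, w] :: 'a::zero^4) $ 3 = z"
  "(vector [x, y, z, w] :: 'a::zero^4) $ 4 = w"
  unfolding vector_def by simp_all

text \<open>
  The blocks of \<open>M_mat\<close> are multiplication by \<open>A\<close> and \<open>B\<close> written in real and imaginary parts, and
  tensoring with the identity makes the Hessian act on every coordinate separately. Hence the
  generalized Hessian is the derivative of the gradient field, paired coordinate by coordinate.
  This removes all \<open>4 \<times> 4\<close> matrices from the rest of the argument.
\<close>

lemma gen_hessian_eq_gradient_derivative:
  fixes F :: "complex \<Rightarrow> complex \<Rightarrow> real" and G G' :: "complex \<times> complex \<Rightarrow> complex \<times> complex"
  assumes "open S" "(u, v) \<in> S"
    and grad: "\<And>z. z \<in> S \<Longrightarrow> ((\<lambda>(x, y). F x y) has_derivative (\<lambda>h. G z \<bullet> h)) (at z)"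
    and G': "(G has_derivative G') (at (u, v))"
  shows "gen_hessian A B F u v \<zeta> \<eta>
    = (\<Sum>k\<in>UNIV. G' ((A *v \<zeta>) $ k, (B *v \<eta>) $ k) \<bullet> (\<zeta> $ k, \<eta> $ k))"
proof -
  define emb :: "real^4 \<Rightarrow> complex \<times> complex"
    where "emb = (\<lambda>x. (Complex (x $ 1) (x $ 2), Complex (x $ 3) (x $ 4)))"
  define x0 :: "real^4" where "x0 = vector [Re u, Im u, Re v, Im v]"
  have emb_x0: "emb x0 = (u, v)" by (simp add: emb_def x0_def)
  have emb_line: "emb (x + t *\<^sub>R y) = emb x + t *\<^sub>R emb y" for x y t
    by (simp add: emb_def complex_eq_iff)
  let ?g = "\<lambda>x :: real^4. F (Complex (x $ 1) (x $ 2)) (Complex (x $ 3) (x $ 4))"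
  have g_eq: "?g = (\<lambda>x. (\<lambda>(x, y). F x y) (emb x))" by (simp add: emb_def)
  have line: "((\<lambda>t. emb x + t *\<^sub>R emb y) has_derivative (\<lambda>t. t *\<^sub>R emb y)) (at t)" for x y and t :: real
    by (auto intro!: derivative_eq_intros)
  have first: "partial_deriv j ?g x = G (emb x) \<bullet> emb (axis j 1)" if "emb x \<in> S" for x j
  proof -
    have "((\<lambda>t. (\<lambda>(x, y). F x y) (emb x + t *\<^sub>R emb (axis j 1)))
        has_derivative (\<lambda>t. G (emb x) \<bullet> (t *\<^sub>R emb (axis j 1)))) (at 0)"
    proof -
      have "((\<lambda>(x, y). F x y) has_derivative (\<lambda>h. G (emb x) \<bullet> h))
          (at (emb x + 0 *\<^sub>R emb (axis j 1)))"
        using grad[OF that] by simp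
      from has_derivative_compose[OF line this] show ?thesis .
    qed
    then have "((\<lambda>t. (\<lambda>(x, y). F x y) (emb x + t *\<^sub>R emb (axis j 1)))
        has_field_derivative (G (emb x) \<bullet> emb (axis j 1))) (at 0)"
      by (simp add: has_field_derivative_def mult_commute_abs)
    then show ?thesis
      unfolding partial_deriv_def g_eq emb_line by (rule DERIV_imp_deriv)
  qed
  have second: "partial_deriv i (partial_deriv j ?g) x0 = G' (emb (axis i 1)) \<bullet> emb (axis j 1)" for i j
  proof -
    have "\<forall>\<^sub>F t in nhds (0::real). emb x0 + t *\<^sub>R emb (axis i 1) \<in> S"
    proof -
      have "open ((\<lambda>t::real. emb x0 + t *\<^sub>R emb (axis i 1)) -` S)"
        by (intro open_vimage assms(1) continuous_intros)
      then show ?thesis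
        using assms(2) by (auto simp: eventually_nhds emb_x0)
    qed
    then have "\<forall>\<^sub>F t in nhds 0. partial_deriv j ?g (x0 + t *\<^sub>R axis i 1)
        = G (emb x0 + t *\<^sub>R emb (axis i 1)) \<bullet> emb (axis j 1)"
      by eventually_elim (simp add: first emb_line)
    then have "partial_deriv i (partial_deriv j ?g) x0
        = deriv (\<lambda>t. G (emb x0 + t *\<^sub>R emb (axis i 1)) \<bullet> emb (axis j 1)) 0"
      unfolding partial_deriv_def[of i] by (rule deriv_cong_ev) simp
    also have "\<dots> = G' (emb (axis i 1)) \<bullet> emb (axis j 1)"
    proof (rule DERIV_imp_deriv)
      have "(G has_derivative G') (at (emb x0 + 0 *\<^sub>R emb (axis i 1)))"
        using G' by (simp add: emb_x0)
      from has_derivative_compose[OF line this]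
      have "((\<lambda>t. G (emb x0 + t *\<^sub>R emb (axis i 1)) \<bullet> emb (axis j 1))
          has_derivative (\<lambda>t. G' (t *\<^sub>R emb (axis i 1)) \<bullet> emb (axis j 1))) (at 0)"
        by (rule has_derivative_inner_left)
      then show "((\<lambda>t. G (emb x0 + t *\<^sub>R emb (axis i 1)) \<bullet> emb (axis j 1))
          has_field_derivative G' (emb (axis i 1)) \<bullet> emb (axis j 1)) (at 0)"
        using linear_scale[OF has_derivative_linear[OF G']]
        by (simp add: has_field_derivative_def mult_commute_abs)
    qed
    finally show ?thesis .
  qed
  define N where "N = (\<lambda>i j. G' (emb (axis i 1)) \<bullet> emb (axis j 1))"
  have Hess: "Hess F u v $ i $ j = N i j" for i j
    by (simp add: Hess_def hessian_def x0_def[symmetric] second N_def)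
  have expand: "emb x = (\<Sum>i\<in>UNIV. (x $ i) *\<^sub>R emb (axis i 1))" for x
    by (simp add: emb_def sum_4 axis_def complex_eq_iff)
  have bilinear: "(\<Sum>i\<in>UNIV. \<Sum>j\<in>UNIV. N i j * x $ i * y $ j) = G' (emb x) \<bullet> emb y" for x y
  proof -
    have "G' (emb x) = (\<Sum>i\<in>UNIV. (x $ i) *\<^sub>R G' (emb (axis i 1)))"
      unfolding expand[of x] using has_derivative_linear[OF G']
      by (simp add: linear_sum linear_scale)
    then show ?thesis
      unfolding expand[of y]
      by (simp add: N_def inner_sum_left inner_sum_right sum_distrib_left mult_ac)
        (rule sum.swap)
  qed
  \<comment> \<open>The \<open>k\<close>-th coordinates of the four blocks of a vector in \<open>(\<real>\<^sup>d)\<^sup>4\<close>, as a vector in \<open>\<real>\<^sup>4\<close>.\<close>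
  define w where "w = (\<lambda>k. \<chi> i. w_vec \<zeta> \<eta> $ (i, k))"
  define q where "q = (\<lambda>k. \<chi> i. (M_mat A B *v w_vec \<zeta> \<eta>) $ (i, k))"
  have w: "emb (w k) = (\<zeta> $ k, \<eta> $ k)" for k
    by (simp add: emb_def w_def w_vec_def Re_vec_def Im_vec_def)
  have sum_prod: "(\<Sum>a\<in>UNIV. f a) = (\<Sum>i\<in>UNIV. \<Sum>k\<in>UNIV. f (i, k))" for f :: "4 \<times> 'a \<Rightarrow> real"
    by (simp add: sum.cartesian_product flip: UNIV_Times_UNIV)
  have q: "emb (q k) = ((A *v \<zeta>) $ k, (B *v \<eta>) $ k)" for k
    by (simp add: emb_def q_def matrix_vector_mult_def sum_prod M_mat_def w_vec_def sum_4
        Re_vec_def Im_vec_def Re_mat_def Im_mat_def complex_eq_iff sum.distrib sum_subtractf sum_negf)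
  have kron: "(kronecker (Hess F u v) (mat 1) *v w_vec \<zeta> \<eta>) $ (i, k) = (\<Sum>j\<in>UNIV. N i j * w k $ j)" for i k
  proof -
    have "(\<Sum>l\<in>UNIV. N i j * mat 1 $ k $ l * w_vec \<zeta> \<eta> $ (j, l)) = N i j * w k $ j" for j
      by (simp add: mat_def w_def if_distrib if_distribR cong: if_cong)
    then show ?thesis
      by (simp add: matrix_vector_mult_def kronecker_def sum_prod Hess)
  qed
  have "gen_hessian A B F u v \<zeta> \<eta>
      = (\<Sum>i\<in>UNIV. \<Sum>k\<in>UNIV. (\<Sum>j\<in>UNIV. N i j * w k $ j) * q k $ i)"
    unfolding gen_hessian_def inner_vec_def sum_prod by (simp add: kron q_def)
  also have "\<dots> = (\<Sum>k\<in>UNIV. \<Sum>i\<in>UNIV. \<Sum>j\<in>UNIV. N i j * q k $ i * w k $ j)"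
    by (subst sum.swap) (simp add: sum_distrib_left sum_distrib_right mult_ac)
  also have "\<dots> = (\<Sum>k\<in>UNIV. G' ((A *v \<zeta>) $ k, (B *v \<eta>) $ k) \<bullet> (\<zeta> $ k, \<eta> $ k))"
    by (simp add: bilinear w q)
  finally show ?thesis .
qed

lemma has_derivative_radial:
  fixes u :: "'a::real_inner"
  assumes "(f has_real_derivative f') (at (norm u))" "u \<noteq> 0"
  shows "((\<lambda>z. f (norm z)) has_derivative (\<lambda>h. f' * (sgn u \<bullet> h))) (at u)"
  using has_derivative_compose[OF has_derivative_norm[OF assms(2)], of f "(*) f'"] assms(1)
  by (simp add: has_field_derivative_def inner_commute)

lemma has_derivative_radial_fst_snd:
  fixes u :: "'a::real_inner" and v :: "'b::real_inner"
  shows "(f has_real_derivative f') (at (norm u)) \<Longrightarrow> u \<noteq> 0 \<Longrightarrow>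
      ((\<lambda>z. f (norm (fst z))) has_derivative (\<lambda>h. f' * (sgn u \<bullet> fst h))) (at (u, v))"
    and "(f has_real_derivative f') (at (norm v)) \<Longrightarrow> v \<noteq> 0 \<Longrightarrow>
      ((\<lambda>z. f (norm (snd z))) has_derivative (\<lambda>h. f' * (sgn v \<bullet> snd h))) (at (u, v))"
proof -
  assume "(f has_real_derivative f') (at (norm u))" "u \<noteq> 0"
  then have "((\<lambda>z. f (norm z)) has_derivative (\<lambda>h. f' * (sgn u \<bullet> h))) (at (fst (u, v)))"
    by (simp add: has_derivative_radial)
  from has_derivative_compose[OF bounded_linear_imp_has_derivative[OF bounded_linear_fst] this]
  show "((\<lambda>z. f (norm (fst z))) has_derivative (\<lambda>h. f' * (sgn u \<bullet> fst h))) (at (u, v))" .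
next
  assume "(f has_real_derivative f') (at (norm v))" "v \<noteq> 0"
  then have "((\<lambda>z. f (norm z)) has_derivative (\<lambda>h. f' * (sgn v \<bullet> h))) (at (snd (u, v)))"
    by (simp add: has_derivative_radial)
  from has_derivative_compose[OF bounded_linear_imp_has_derivative[OF bounded_linear_snd] this]
  show "((\<lambda>z. f (norm (snd z))) has_derivative (\<lambda>h. f' * (sgn v \<bullet> snd h))) (at (u, v))" .
qed

text \<open>
  Both branches of the Bellman function have this shape; below the interface \<open>c = 0\<close>. A radial
  function \<open>a (cmod u)\<close> has gradient \<open>(a1 r / r) *\<^sub>R u\<close>, whose derivative is \<open>a1 r / r\<close> times the
  identity plus \<open>a2 r - a1 r / r\<close> times the projection onto the direction of \<open>u\<close>. The mixed second
  derivatives of \<open>(cmod u)\<^sup>2 * g (cmod v)\<close> see radial directions only.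
\<close>

lemma gen_hessian_biradial:
  fixes A B :: "complex^'n^'n"
  assumes a: "\<And>r. r > 0 \<Longrightarrow> (a has_real_derivative a1 r) (at r)"
      "\<And>r. r > 0 \<Longrightarrow> (a1 has_real_derivative a2 r) (at r)"
    and b: "\<And>r. r > 0 \<Longrightarrow> (b has_real_derivative b1 r) (at r)"
      "\<And>r. r > 0 \<Longrightarrow> (b1 has_real_derivative b2 r) (at r)"
    and g: "\<And>r. r > 0 \<Longrightarrow> (g has_real_derivative g1 r) (at r)"
      "\<And>r. r > 0 \<Longrightarrow> (g1 has_real_derivative g2 r) (at r)"
    and S: "open S" "(u, v) \<in> S" "S \<subseteq> {(x, y). x \<noteq> 0 \<and> y \<noteq> 0}"
    and F: "\<And>x y. (x, y) \<in> S \<Longrightarrow> F x y = a (cmod x) + b (cmod y) + c * (cmod x)\<^sup>2 * g (cmod y)"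
  defines "r \<equiv> cmod u" and "t \<equiv> cmod v"
  shows "gen_hessian A B F u v \<zeta> \<eta> =
    polar_form (a2 r) (a1 r / r) (sgn u) A \<zeta> + polar_form (b2 t) (b1 t / t) (sgn v) B \<eta>
    + c * (2 * g t * ((A *v \<zeta>) \<bullet> \<zeta>) + r\<^sup>2 * polar_form (g2 t) (g1 t / t) (sgn v) B \<eta>
       + 2 * r * g1 t * ((\<Sum>k\<in>UNIV. (sgn v \<bullet> (B *v \<eta>) $ k) * (sgn u \<bullet> \<zeta> $ k))
                       + (\<Sum>k\<in>UNIV. (sgn u \<bullet> (A *v \<zeta>) $ k) * (sgn v \<bullet> \<eta> $ k))))"
proof -
  have uv: "u \<noteq> 0" "v \<noteq> 0" using S by auto
  then have rt: "r > 0" "t > 0" by (simp_all add: r_def t_def)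
  \<comment> \<open>The two components of the gradient, and their derivatives at the given point.\<close>
  define P where "P = (\<lambda>z :: complex \<times> complex.
    (a1 (norm (fst z)) / norm (fst z) + 2 * c * g (norm (snd z))) *\<^sub>R fst z)"
  define Q where "Q = (\<lambda>z :: complex \<times> complex.
    (b1 (norm (snd z)) / norm (snd z) + c * (norm (fst z))\<^sup>2 * (g1 (norm (snd z)) / norm (snd z))) *\<^sub>R snd z)"
  define P' where "P' = (\<lambda>h :: complex \<times> complex.
    (a1 r / r + 2 * c * g t) *\<^sub>R fst h + ((a2 r - a1 r / r) * (sgn u \<bullet> fst h)) *\<^sub>R sgn u
      + (2 * c * r * g1 t * (sgn v \<bullet> snd h)) *\<^sub>R sgn u)"
  define Q' where "Q' = (\<lambda>h :: complex \<times> complex.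
    (b1 t / t + c * r\<^sup>2 * (g1 t / t)) *\<^sub>R snd h
      + ((b2 t - b1 t / t + c * r\<^sup>2 * (g2 t - g1 t / t)) * (sgn v \<bullet> snd h)) *\<^sub>R sgn v
      + (2 * c * r * g1 t * (sgn u \<bullet> fst h)) *\<^sub>R sgn v)"
  have sq: "((\<lambda>x. x\<^sup>2) has_real_derivative 2 * r) (at r)" for r
    by (auto intro!: derivative_eq_intros)
  have grad: "((\<lambda>(x, y). F x y) has_derivative (\<lambda>h. (P z, Q z) \<bullet> h)) (at z)" if z: "z \<in> S" for z
  proof -
    obtain x y where xy: "z = (x, y)" by (cases z)
    have nz: "x \<noteq> 0" "y \<noteq> 0" using z S xy by auto
    have "((\<lambda>z. a (cmod (fst z)) + b (cmod (snd z)) + c * ((cmod (fst z))\<^sup>2 * g (cmod (snd z))))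
        has_derivative (\<lambda>h. (P z, Q z) \<bullet> h)) (at (x, y))"
    proof (rule has_derivative_eq_rhs)
      show "((\<lambda>z. a (cmod (fst z)) + b (cmod (snd z)) + c * ((cmod (fst z))\<^sup>2 * g (cmod (snd z))))
        has_derivative (\<lambda>h. a1 (cmod x) * (sgn x \<bullet> fst h) + b1 (cmod y) * (sgn y \<bullet> snd h)
          + c * ((cmod (fst (x, y)))\<^sup>2 * (g1 (cmod y) * (sgn y \<bullet> snd h))
              + (2 * cmod x * (sgn x \<bullet> fst h)) * g (cmod (snd (x, y)))))) (at (x, y))"
        using nz
        by (intro has_derivative_add has_derivative_mult_right has_derivative_mult
            has_derivative_radial_fst_snd[OF a(1)] has_derivative_radial_fst_snd(2)[OF b(1)]
            has_derivative_radial_fst_snd(2)[OF g(1)] has_derivative_radial_fst_snd(1)[OF sq]) auto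
    next
      have x: "x \<bullet> w = cmod x * (sgn x \<bullet> w)" and y: "y \<bullet> w = cmod y * (sgn y \<bullet> w)" for w
        using nz by (simp_all add: sgn_div_norm)
      have "(P z, Q z) \<bullet> h = a1 (cmod x) * (sgn x \<bullet> fst h) + b1 (cmod y) * (sgn y \<bullet> snd h)
          + c * ((cmod x)\<^sup>2 * (g1 (cmod y) * (sgn y \<bullet> snd h))
              + (2 * cmod x * (sgn x \<bullet> fst h)) * g (cmod y))" for h
      proof -
        have PQ: "P z \<bullet> fst h = (a1 (cmod x) / cmod x + 2 * c * g (cmod y)) * (cmod x * (sgn x \<bullet> fst h))"
          and QQ: "Q z \<bullet> snd h = (b1 (cmod y) / cmod y + c * (cmod x)\<^sup>2 * (g1 (cmod y) / cmod y))
            * (cmod y * (sgn y \<bullet> snd h))"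
          by (simp_all add: P_def Q_def xy x[symmetric] y[symmetric])
        show ?thesis
          unfolding inner_prod_def fst_conv snd_conv PQ QQ using nz by (simp add: field_simps)
      qed
      then show "(\<lambda>h. a1 (cmod x) * (sgn x \<bullet> fst h) + b1 (cmod y) * (sgn y \<bullet> snd h)
          + c * ((cmod (fst (x, y)))\<^sup>2 * (g1 (cmod y) * (sgn y \<bullet> snd h))
              + (2 * cmod x * (sgn x \<bullet> fst h)) * g (cmod (snd (x, y))))) = (\<lambda>h. (P z, Q z) \<bullet> h)"
        by simp
    qed
    then have "((\<lambda>(x, y). F x y) has_derivative (\<lambda>h. (P z, Q z) \<bullet> h)) (at (x, y))"
      by (rule has_derivative_transform_within_open[OF _ S(1)])
        (use z xy F in \<open>auto simp: mult.assoc\<close>)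
    then show ?thesis by (simp add: xy)
  qed
  have quot: "((\<lambda>x. f1 x / x) has_real_derivative (f2 - f1 r / r) / r) (at r)"
    if "(f1 has_real_derivative f2) (at r)" "r > 0" for f1 f2 and r :: real
    by (rule derivative_eq_intros that refl)+ (use that in \<open>auto simp: field_simps power2_eq_square\<close>)
  have u: "u = r *\<^sub>R sgn u" and v: "v = t *\<^sub>R sgn v"
    using uv by (simp_all add: r_def t_def sgn_div_norm)
  have P': "(P has_derivative P') (at (u, v))"
  proof (rule has_derivative_eq_rhs)
    show "(P has_derivative (\<lambda>h. (a1 (norm (fst (u, v))) / norm (fst (u, v)) + 2 * c * g (norm (snd (u, v)))) *\<^sub>R fst h
        + ((a2 r - a1 r / r) / r * (sgn u \<bullet> fst h) + 2 * c * (g1 t * (sgn v \<bullet> snd h))) *\<^sub>R fst (u, v)))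
        (at (u, v))"
      unfolding P_def using rt uv
      by (intro has_derivative_scaleR has_derivative_add has_derivative_mult_right
          has_derivative_radial_fst_snd(1)[where f="\<lambda>x. a1 x / x"] has_derivative_radial_fst_snd(2)[where f = g]
          has_derivative_fst has_derivative_ident quot g(1) a(2))
        (auto simp: r_def[symmetric] t_def[symmetric] intro: quot g a)
  next
    have "((a2 r - a1 r / r) / r * (sgn u \<bullet> fst h) + 2 * c * (g1 t * (sgn v \<bullet> snd h))) *\<^sub>R u
        = ((a2 r - a1 r / r) * (sgn u \<bullet> fst h)) *\<^sub>R sgn u
          + (2 * c * r * g1 t * (sgn v \<bullet> snd h)) *\<^sub>R sgn u" for h :: "complex \<times> complex"
    proof -
      have "((a2 r - a1 r / r) / r * (sgn u \<bullet> fst h) + 2 * c * (g1 t * (sgn v \<bullet> snd h))) * r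
          = (a2 r - a1 r / r) * (sgn u \<bullet> fst h) + 2 * c * r * g1 t * (sgn v \<bullet> snd h)"
        using rt(1) by (simp add: distrib_right)
      then show ?thesis
        by (metis (no_types) u scaleR_scaleR scaleR_left_distrib)
    qed
    then show "(\<lambda>h. (a1 (norm (fst (u, v))) / norm (fst (u, v)) + 2 * c * g (norm (snd (u, v)))) *\<^sub>R fst h
        + ((a2 r - a1 r / r) / r * (sgn u \<bullet> fst h) + 2 * c * (g1 t * (sgn v \<bullet> snd h))) *\<^sub>R fst (u, v)) = P'"
      unfolding P'_def fst_conv snd_conv r_def[symmetric] t_def[symmetric] by (simp only: add.assoc)
  qed
  have Q': "(Q has_derivative Q') (at (u, v))"
  proof (rule has_derivative_eq_rhs)
    show "(Q has_derivative (\<lambda>h. (b1 (norm (snd (u, v))) / norm (snd (u, v))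
          + c * (norm (fst (u, v)))\<^sup>2 * (g1 (norm (snd (u, v))) / norm (snd (u, v)))) *\<^sub>R snd h
        + ((b2 t - b1 t / t) / t * (sgn v \<bullet> snd h)
          + ((c * (norm (fst (u, v)))\<^sup>2) * ((g2 t - g1 t / t) / t * (sgn v \<bullet> snd h))
            + (c * (2 * r * (sgn u \<bullet> fst h))) * (g1 (norm (snd (u, v))) / norm (snd (u, v))))) *\<^sub>R snd (u, v)))
        (at (u, v))"
      unfolding Q_def using rt uv
      by (intro has_derivative_scaleR has_derivative_add has_derivative_mult has_derivative_mult_right
          has_derivative_radial_fst_snd(1)[where f="\<lambda>x. x\<^sup>2"]
          has_derivative_radial_fst_snd(2)[where f="\<lambda>x. b1 x / x"] has_derivative_radial_fst_snd(2)[where f="\<lambda>x. g1 x / x"]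
          has_derivative_snd has_derivative_ident)
        (auto simp: r_def[symmetric] t_def[symmetric] intro: quot g b sq)
  next
    have "((b2 t - b1 t / t) / t * (sgn v \<bullet> snd h)
          + ((c * r\<^sup>2) * ((g2 t - g1 t / t) / t * (sgn v \<bullet> snd h))
            + (c * (2 * r * (sgn u \<bullet> fst h))) * (g1 t / t))) *\<^sub>R v
        = ((b2 t - b1 t / t + c * r\<^sup>2 * (g2 t - g1 t / t)) * (sgn v \<bullet> snd h)) *\<^sub>R sgn v
          + (2 * c * r * g1 t * (sgn u \<bullet> fst h)) *\<^sub>R sgn v" for h :: "complex \<times> complex"
    proof -
      have "((b2 t - b1 t / t) / t * (sgn v \<bullet> snd h)
          + ((c * r\<^sup>2) * ((g2 t - g1 t / t) / t * (sgn v \<bullet> snd h))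
            + (c * (2 * r * (sgn u \<bullet> fst h))) * (g1 t / t))) * t
        = (b2 t - b1 t / t + c * r\<^sup>2 * (g2 t - g1 t / t)) * (sgn v \<bullet> snd h)
          + 2 * c * r * g1 t * (sgn u \<bullet> fst h)"
        using rt(2) by (simp add: distrib_right)
      then show ?thesis
        by (metis (no_types) v scaleR_scaleR scaleR_left_distrib)
    qed
    then show "(\<lambda>h. (b1 (norm (snd (u, v))) / norm (snd (u, v))
          + c * (norm (fst (u, v)))\<^sup>2 * (g1 (norm (snd (u, v))) / norm (snd (u, v)))) *\<^sub>R snd h
        + ((b2 t - b1 t / t) / t * (sgn v \<bullet> snd h)
          + ((c * (norm (fst (u, v)))\<^sup>2) * ((g2 t - g1 t / t) / t * (sgn v \<bullet> snd h))
            + (c * (2 * r * (sgn u \<bullet> fst h))) * (g1 (norm (snd (u, v))) / norm (snd (u, v))))) *\<^sub>R snd (u, v)) = Q'"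
      unfolding Q'_def fst_conv snd_conv r_def[symmetric] t_def[symmetric] by (simp only: add.assoc)
  qed
  have G': "((\<lambda>z. (P z, Q z)) has_derivative (\<lambda>h. (P' h, Q' h))) (at (u, v))"
    using P' Q' by (rule has_derivative_Pair)
  have unit: "cmod (sgn u) = 1" "cmod (sgn v) = 1"
    using uv by (simp_all add: norm_sgn)
  have "gen_hessian A B F u v \<zeta> \<eta> =
      (\<Sum>k\<in>UNIV. (P' ((A *v \<zeta>) $ k, (B *v \<eta>) $ k), Q' ((A *v \<zeta>) $ k, (B *v \<eta>) $ k)) \<bullet> (\<zeta> $ k, \<eta> $ k))"
    by (rule gen_hessian_eq_gradient_derivative[OF S(1,2) grad G'])
  also have "\<dots> = (\<Sum>k\<in>UNIV. (a1 r / r * ((A *v \<zeta>) $ k \<bullet> \<zeta> $ k)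
        + (a2 r - a1 r / r) * (sgn u \<bullet> (A *v \<zeta>) $ k) * (sgn u \<bullet> \<zeta> $ k))
      + (b1 t / t * ((B *v \<eta>) $ k \<bullet> \<eta> $ k)
        + (b2 t - b1 t / t) * (sgn v \<bullet> (B *v \<eta>) $ k) * (sgn v \<bullet> \<eta> $ k))
      + c * (2 * g t * ((A *v \<zeta>) $ k \<bullet> \<zeta> $ k)
        + r\<^sup>2 * (g1 t / t * ((B *v \<eta>) $ k \<bullet> \<eta> $ k)
          + (g2 t - g1 t / t) * (sgn v \<bullet> (B *v \<eta>) $ k) * (sgn v \<bullet> \<eta> $ k))
        + 2 * r * g1 t * ((sgn v \<bullet> (B *v \<eta>) $ k) * (sgn u \<bullet> \<zeta> $ k)
          + (sgn u \<bullet> (A *v \<zeta>) $ k) * (sgn v \<bullet> \<eta> $ k))))"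
    by (intro sum.cong refl)
      (simp add: P'_def Q'_def inner_prod_def inner_add_left algebra_simps)
  also have "\<dots> = polar_form (a2 r) (a1 r / r) (sgn u) A \<zeta> + polar_form (b2 t) (b1 t / t) (sgn v) B \<eta>
    + c * (2 * g t * ((A *v \<zeta>) \<bullet> \<zeta>) + r\<^sup>2 * polar_form (g2 t) (g1 t / t) (sgn v) B \<eta>
       + 2 * r * g1 t * ((\<Sum>k\<in>UNIV. (sgn v \<bullet> (B *v \<eta>) $ k) * (sgn u \<bullet> \<zeta> $ k))
                       + (\<Sum>k\<in>UNIV. (sgn u \<bullet> (A *v \<zeta>) $ k) * (sgn v \<bullet> \<eta> $ k))))"
    unfolding polar_form_eq_sum[OF unit(1), symmetric] polar_form_eq_sum[OF unit(2), symmetric]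
      sum.distrib sum_distrib_left[symmetric] inner_vec_def ..
  finally show ?thesis .
qed

section \<open>Calculus on the half-line\<close>

text \<open>
  The integrals in the Bellman function have integrands \<open>q\<close> that may be unbounded at \<open>0\<close>. Both are
  controlled by a function \<open>K\<close> vanishing at \<open>0\<close> with \<open>c * q \<le> K' \<le> C * q\<close>: the first inequality
  makes \<open>q\<close> integrable, the second compares its integral with \<open>K\<close>.
\<close>

lemma integral_between_derivative_bounds:
  fixes q K K' :: "real \<Rightarrow> real" and c C :: real
  assumes K0: "K 0 = 0" "(K \<longlongrightarrow> 0) (at_right 0)"
    and K: "\<And>s. s > 0 \<Longrightarrow> (K has_real_derivative K' s) (at s)"
    and q: "\<And>s. s > 0 \<Longrightarrow> isCont q s" "\<And>s. s > 0 \<Longrightarrow> q s > 0"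
    and c: "c > 0" "\<And>s. s > 0 \<Longrightarrow> c * q s \<le> K' s"
    and C: "\<And>s. s > 0 \<Longrightarrow> K' s \<le> C * q s"
    and r: "r > 0"
  shows "((\<lambda>x. integral {0..x} q) has_real_derivative q r) (at r)"
    and "K r \<le> C * integral {0..r} q"
proof -
  have K'_int: "(K' has_integral K R) {0..R}" if "R > 0" for R
  proof -
    have "continuous_on {0..R} K"
      unfolding continuous_on_eq_continuous_within
    proof
      fix x assume x: "x \<in> {0..R}"
      show "continuous (at x within {0..R}) K"
      proof (cases "x = 0")
        case True
        have "at 0 within {0..R} = at_right 0"
          using that by (simp add: at_within_Icc_at_right)
        then show ?thesis using K0 True by (simp add: continuous_within)
      next
        case False
        with x have "x > 0" by simp
        from DERIV_isCont[OF K[OF this]] show ?thesis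
          by (rule continuous_at_imp_continuous_at_within)
      qed
    qed
    then have "(K' has_integral K R - K 0) {0..R}"
      using that K
      by (intro fundamental_theorem_of_calculus_interior)
        (auto simp: has_real_derivative_iff_has_vector_derivative)
    then show ?thesis using K0 by simp
  qed
  have q_int: "q integrable_on {0..R}" if "R > 0" for R
  proof -
    have "q integrable_on {0<..<R}"
    proof (rule measurable_bounded_by_integrable_imp_integrable)
      show "q \<in> borel_measurable (lebesgue_on {0<..<R})"
        by (intro continuous_imp_measurable_on_sets_lebesgue continuous_at_imp_continuous_on ballI q)
          auto
      show "(\<lambda>s. K' s / c) integrable_on {0<..<R}"
        using integrable_on_cmult_left[OF has_integral_integrable[OF K'_int[OF that]], of "1 / c"]
        by (simp add: integrable_on_Icc_iff_Ioo)
      show "norm (q s) \<le> K' s / c" if "s \<in> {0<..<R}" for s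
        using c(1) c(2)[of s] q(2)[of s] that by (simp add: field_simps)
    qed auto
    then show ?thesis by (simp add: integrable_on_Icc_iff_Ioo)
  qed
  have "((\<lambda>x. integral {0..x} q) has_vector_derivative q r) (at r within ({0..2 * r} - {}))"
    using r by (intro integral_has_vector_derivative_continuous_at q_int
        continuous_at_imp_continuous_at_within[OF q(1)]) auto
  then show "((\<lambda>x. integral {0..x} q) has_real_derivative q r) (at r)"
    using r by (simp add: at_within_Icc_at has_real_derivative_iff_has_vector_derivative)
  have "(K' has_integral K r) {0<..<r}"
    using K'_int[OF r] by (simp add: has_integral_Icc_iff_Ioo)
  moreover have "((\<lambda>s. C * q s) has_integral C * integral {0..r} q) {0<..<r}"
    using has_integral_mult_right[OF integrable_integral[OF q_int[OF r]], of C]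
    by (simp add: has_integral_Icc_iff_Ioo)
  ultimately show "K r \<le> C * integral {0..r} q"
    by (rule has_integral_le) (use C in auto)
qed

lemma hderiv_has_real_derivative:
  assumes "C1_C2_halfline f" "s > 0"
  shows "(f has_real_derivative hderiv f s) (at s)"
    and "(hderiv f has_real_derivative hderiv (hderiv f) s) (at s)"
proof -
  have at: "at s within {0..} = at s"
    using assms(2) by (intro at_within_interior) simp
  have "f differentiable at s"
    using assms at by (auto simp: C1_C2_halfline_def differentiable_on_def dest!: bspec[of _ _ s])
  then show "(f has_real_derivative hderiv f s) (at s)"
    by (simp add: hderiv_def at vector_derivative_works has_real_derivative_iff_has_vector_derivative)
  have "hderiv f differentiable at s"
    using assms at_within_open[of s "{0<..}"]
    by (auto simp: C1_C2_halfline_def differentiable_on_def dest!: bspec[of _ _ s])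
  then show "(hderiv f has_real_derivative hderiv (hderiv f) s) (at s)"
    by (simp add: hderiv_def[of "hderiv f"] at vector_derivative_works has_real_derivative_iff_has_vector_derivative)
qed

lemma convex_above_tangent:
  assumes "C1_C2_halfline f" "convex_on {0..} f" "s > 0" "x \<ge> 0"
  shows "f s + hderiv f s * (x - s) \<le> f x"
proof -
  have "hderiv f s * (x - s) \<le> f x - f s"
    by (rule convex_on_imp_above_tangent[OF assms(2) _ _ _
          has_field_derivative_at_within[OF hderiv_has_real_derivative(1)[OF assms(1,3)]]])
      (use assms in auto)
  then show ?thesis by simp
qed

lemma hderiv_strict_mono:
  assumes "C1_C2_halfline f" "\<And>s. s > 0 \<Longrightarrow> hderiv (hderiv f) s > 0" "0 < x" "x < y"
  shows "hderiv f x < hderiv f y"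
proof (rule DERIV_pos_imp_increasing[OF assms(4)])
  fix z assume "x \<le> z" "z \<le> y"
  then have "z > 0" using assms(3) by simp
  then show "\<exists>d. (hderiv f has_real_derivative d) (at z) \<and> 0 < d"
    using assms(2) hderiv_has_real_derivative(2)[OF assms(1)] by blast
qed

lemma hderiv_pos:
  assumes "C1_C2_halfline f" "convex_on {0..} f" "\<And>s. s > 0 \<Longrightarrow> hderiv (hderiv f) s > 0"
    "f 0 = 0" "\<And>s. s \<ge> 0 \<Longrightarrow> f s \<ge> 0" "s > 0"
  shows "hderiv f s > 0"
proof -
  have "0 \<le> f (s / 2)" using assms by simp
  also have "f (s / 2) \<le> hderiv f (s / 2) * (s / 2)"
    using convex_above_tangent[OF assms(1,2), of "s / 2" 0] assms by simp
  finally have "0 \<le> hderiv f (s / 2)" using assms(6) by (simp add: zero_le_mult_iff)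
  also have "\<dots> < hderiv f s" using assms by (intro hderiv_strict_mono) auto
  finally show ?thesis .
qed

text \<open>
  Young's inequality \<open>s * \<tau> - f s \<le> g \<tau>\<close> is an equality at \<open>\<tau> = f' s\<close>, so \<open>\<tau> \<mapsto> g \<tau> - s * \<tau>\<close> has a
  minimum there and its derivative vanishes.
\<close>

lemma hderiv_complementary_inverse:
  assumes f: "C1_C2_halfline f" "convex_on {0..} f" and g: "C1_C2_halfline g"
    and compl: "\<And>t. t \<ge> 0 \<Longrightarrow> g t = complementary_young f t"
    and bdd: "\<And>t. t > 0 \<Longrightarrow> bdd_above ((\<lambda>s. s * t - f s) ` {0<..})"
    and s: "s > 0" "hderiv f s > 0"
  shows "hderiv g (hderiv f s) = s"
proof -
  define t where "t = hderiv f s"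
  have t: "t > 0" using s by (simp add: t_def)
  have above: "s * \<tau> - f s \<le> g \<tau>" if "\<tau> > 0" for \<tau>
    unfolding compl[OF less_imp_le[OF that]] complementary_young_def
    by (rule cSUP_upper2[OF bdd[OF that]]) (use s in auto)
  \<comment> \<open>By convexity the supremum defining the conjugate at \<open>f' s\<close> is attained at \<open>s\<close>.\<close>
  have "g t \<le> s * t - f s"
    unfolding compl[OF less_imp_le[OF t]] complementary_young_def
    using convex_above_tangent[OF f s(1)]
    by (intro cSUP_least) (force simp: t_def algebra_simps)+
  have "hderiv g t - s = 0"
  proof (rule DERIV_local_min)
    show "((\<lambda>\<tau>. g \<tau> - s * \<tau>) has_real_derivative hderiv g t - s) (at t)"
      by (auto intro!: derivative_eq_intros hderiv_has_real_derivative(1)[OF g t])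
    show "0 < t" by fact
    show "\<forall>\<tau>. \<bar>t - \<tau>\<bar> < t \<longrightarrow> g t - s * t \<le> g \<tau> - s * \<tau>"
    proof (intro allI impI)
      fix \<tau> assume "\<bar>t - \<tau>\<bar> < t"
      then have "\<tau> > 0" by linarith
      from above[OF this] \<open>g t \<le> s * t - f s\<close> show "g t - s * t \<le> g \<tau> - s * \<tau>" by linarith
    qed
  qed
  then show ?thesis by (simp add: t_def)
qed

lemma bdd_above_complementary_young:
  assumes "young_function f"
  shows "bdd_above ((\<lambda>s. s * t - f s) ` {0<..})"
proof -
  have "\<forall>\<^sub>F s in at_top. \<bar>t\<bar> \<le> f s / s"
    using assms by (simp add: young_function_def filterlim_at_top)
  then obtain R where R: "\<And>s. s \<ge> R \<Longrightarrow> \<bar>t\<bar> \<le> f s / s"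
    by (auto simp: eventually_at_top_linorder)
  show ?thesis
  proof (rule bdd_aboveI2)
    fix s :: real assume s: "s \<in> {0<..}"
    show "s * t - f s \<le> \<bar>R\<bar> * \<bar>t\<bar>"
    proof (cases "s \<ge> R")
      case True
      have "s * t \<le> s * \<bar>t\<bar>" using s by (simp add: mult_left_mono)
      also have "\<dots> \<le> f s" using R[OF True] s by (simp add: field_simps)
      finally show ?thesis by (smt (verit) mult_nonneg_nonneg)
    next
      case False
      have "s * t \<le> s * \<bar>t\<bar>" using s by (simp add: mult_left_mono)
      also have "\<dots> \<le> \<bar>R\<bar> * \<bar>t\<bar>" using False s by (intro mult_right_mono) auto
      finally have "s * t \<le> \<bar>R\<bar> * \<bar>t\<bar>" .
      moreover have "0 \<le> f s" using assms s by (simp add: young_function_def)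
      ultimately show ?thesis by linarith
    qed
  qed
qed

section \<open>Admissible pairs\<close>

locale admissible =
  fixes \<Phi> \<Psi> :: "real \<Rightarrow> real"
  assumes adm: "admissible_pair \<Phi> \<Psi>"
begin

abbreviation \<phi> :: "real \<Rightarrow> real" where "\<phi> \<equiv> hderiv \<Phi>"
abbreviation \<phi>' :: "real \<Rightarrow> real" where "\<phi>' \<equiv> hderiv (hderiv \<Phi>)"
abbreviation \<psi> :: "real \<Rightarrow> real" where "\<psi> \<equiv> hderiv \<Psi>"
abbreviation \<psi>' :: "real \<Rightarrow> real" where "\<psi>' \<equiv> hderiv (hderiv \<Psi>)"
abbreviation m :: real where "m \<equiv> m_tilde \<Phi>"
abbreviation M :: real where "M \<equiv> M_tilde \<Phi>"

lemma young: "young_function \<Phi>" "young_function \<Psi>"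
  and smooth: "C1_C2_halfline \<Phi>" "C1_C2_halfline \<Psi>"
  and second_pos: "\<And>s. s > 0 \<Longrightarrow> \<phi>' s > 0" "\<And>s. s > 0 \<Longrightarrow> \<psi>' s > 0"
  and m_gt_1: "m > 1"
  using adm by (auto simp: admissible_pair_def)

lemmas has_derivs =
  hderiv_has_real_derivative[OF smooth(1)] hderiv_has_real_derivative[OF smooth(2)]

lemma convex: "convex_on {0..} \<Phi>" "convex_on {0..} \<Psi>"
  and zero: "\<Phi> 0 = 0" "\<Psi> 0 = 0"
  and nonneg: "\<And>s. s \<ge> 0 \<Longrightarrow> \<Phi> s \<ge> 0" "\<And>s. s \<ge> 0 \<Longrightarrow> \<Psi> s \<ge> 0"
  and complementary: "\<And>t. t \<ge> 0 \<Longrightarrow> \<Psi> t = complementary_young \<Phi> t"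
    "\<And>s. s \<ge> 0 \<Longrightarrow> \<Phi> s = complementary_young \<Psi> s"
  using adm by (auto simp: admissible_pair_def young_function_def)

lemma \<phi>_pos: "s > 0 \<Longrightarrow> \<phi> s > 0"
  by (rule hderiv_pos[OF smooth(1) convex(1) second_pos(1) zero(1) nonneg(1)])

lemma \<psi>_pos: "s > 0 \<Longrightarrow> \<psi> s > 0"
  by (rule hderiv_pos[OF smooth(2) convex(2) second_pos(2) zero(2) nonneg(2)])

lemma \<psi>_\<phi>: "s > 0 \<Longrightarrow> \<psi> (\<phi> s) = s"
  by (rule hderiv_complementary_inverse[OF smooth(1) convex(1) smooth(2) complementary(1)
        bdd_above_complementary_young[OF young(1)] _ \<phi>_pos])

lemma \<phi>_\<psi>: "t > 0 \<Longrightarrow> \<phi> (\<psi> t) = t"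
  by (rule hderiv_complementary_inverse[OF smooth(2) convex(2) smooth(1) complementary(2)
        bdd_above_complementary_young[OF young(2)] _ \<psi>_pos])

lemma \<phi>_strict_mono: "0 < x \<Longrightarrow> x < y \<Longrightarrow> \<phi> x < \<phi> y"
  by (rule hderiv_strict_mono[OF smooth(1) second_pos(1)])

lemma \<psi>_strict_mono: "0 < x \<Longrightarrow> x < y \<Longrightarrow> \<psi> x < \<psi> y"
  by (rule hderiv_strict_mono[OF smooth(2) second_pos(2)])

text \<open>
  Differentiate \<open>\<phi> (\<psi> \<tau>) = \<tau>\<close>.
\<close>

lemma \<psi>'_eq:
  assumes "t > 0" shows "\<psi>' t = 1 / \<phi>' (\<psi> t)"
proof -
  have "((\<lambda>\<tau>. \<phi> (\<psi> \<tau>)) has_real_derivative \<phi>' (\<psi> t) * \<psi>' t) (at t)"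
    by (rule DERIV_chain2[OF has_derivs(2) has_derivs(4)]) (use assms \<psi>_pos in auto)
  moreover have "((\<lambda>\<tau>. \<phi> (\<psi> \<tau>)) has_real_derivative 1) (at t)"
    by (rule has_field_derivative_transform_within_open[where f = "\<lambda>\<tau>. \<tau>" and S = "{0<..}"])
      (use assms \<phi>_\<psi> in auto)
  ultimately have "\<phi>' (\<psi> t) * \<psi>' t = 1" by (rule DERIV_unique)
  then show ?thesis using second_pos(1)[OF \<psi>_pos[OF assms]] by (simp add: field_simps)
qed

lemma index_bounds:
  assumes "s > 0"
  shows "m * \<phi> s \<le> s * \<phi>' s" and "s * \<phi>' s \<le> M * \<phi> s"
proof -
  have "m \<le> s * \<phi>' s / \<phi> s"
    unfolding m_tilde_def
  proof (rule cINF_lower)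
    show "bdd_below ((\<lambda>s. s * \<phi>' s / \<phi> s) ` {0<..})"
      by (rule bdd_belowI2[of _ 0]) (use \<phi>_pos second_pos in \<open>auto intro!: divide_nonneg_pos mult_nonneg_nonneg less_imp_le\<close>)
  qed (use assms in auto)
  then show "m * \<phi> s \<le> s * \<phi>' s" using \<phi>_pos[OF assms] by (simp add: field_simps)
  have "s * \<phi>' s / \<phi> s \<le> M"
    unfolding M_tilde_def
    by (rule cSUP_upper) (use assms adm in \<open>auto simp: admissible_pair_def\<close>)
  then show "s * \<phi>' s \<le> M * \<phi> s" using \<phi>_pos[OF assms] by (simp add: field_simps)
qed

lemma m_le_M: "m \<le> M"
  using index_bounds[of 1] \<phi>_pos[of 1] by (meson mult_le_cancel_right_pos order_trans zero_less_one)

text \<open>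
  At \<open>t = \<phi> s\<close> the quotient \<open>t * \<psi>' t / \<psi> t\<close> is the reciprocal of \<open>s * \<phi>' s / \<phi> s\<close>.
\<close>

lemma dual_index_bounds:
  assumes "t > 0"
  shows "\<psi> t \<le> M * (t * \<psi>' t)" and "m * (t * \<psi>' t) \<le> \<psi> t"
  using index_bounds[OF \<psi>_pos[OF assms]] second_pos(1)[OF \<psi>_pos[OF assms]]
  by (simp_all add: \<phi>_\<psi>[OF assms] \<psi>'_eq[OF assms] field_simps)

lemma index_ge_1:
  assumes "s > 0"
  shows "\<phi> s \<le> s * \<phi>' s" and "s * \<psi>' s \<le> \<psi> s"
proof -
  have "1 * \<phi> s \<le> m * \<phi> s" and "1 * (s * \<psi>' s) \<le> m * (s * \<psi>' s)"
    using m_gt_1 \<phi>_pos[OF assms] second_pos(2)[OF assms] assms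
    by (intro mult_right_mono; simp)+
  then show "\<phi> s \<le> s * \<phi>' s" and "s * \<psi>' s \<le> \<psi> s"
    using index_bounds(1)[OF assms] dual_index_bounds(2)[OF assms] by linarith+
qed

text \<open>
  The derivative of \<open>\<phi> s / s\<close> has the sign of \<open>s * \<phi>' s - \<phi> s\<close>.
\<close>

lemma slope_mono:
  assumes "0 < s" "s \<le> r" shows "\<phi> s / s \<le> \<phi> r / r"
proof (rule DERIV_nonneg_imp_nondecreasing[OF assms(2)])
  fix x assume "s \<le> x" "x \<le> r"
  then have x: "x > 0" using assms by simp
  have "((\<lambda>x. \<phi> x / x) has_real_derivative (x * \<phi>' x - \<phi> x) / x\<^sup>2) (at x)"
    by (rule derivative_eq_intros has_derivs x refl)+ (use x in \<open>auto simp: power2_eq_square algebra_simps\<close>)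
  moreover have "x * \<phi>' x - \<phi> x \<ge> 0"
    using index_ge_1(1)[OF x] by simp
  ultimately show "\<exists>y. ((\<lambda>x. \<phi> x / x) has_real_derivative y) (at x) \<and> 0 \<le> y"
    by (intro exI conjI) auto
qed

lemma slope_tendsto_0: "((\<lambda>s. \<phi> s / s) \<longlongrightarrow> 0) (at_right 0)"
  using adm by (simp add: admissible_pair_def)

text \<open>
  The comparison function is \<open>K s = \<phi> s / s\<close>, with derivative \<open>(s * \<phi>' s - \<phi> s) / s\<^sup>2\<close>, which the
  index bounds place between \<open>(m - 1) * \<phi> s / s\<^sup>2\<close> and \<open>(M - 1) * \<phi> s / s\<^sup>2\<close>.
\<close>

lemma
  assumes "r > 0"
  shows slope_integral_deriv:
      "((\<lambda>r. integral {0..r} (\<lambda>s. \<phi> s / s\<^sup>2)) has_real_derivative \<phi> r / r\<^sup>2) (at r)"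
    and slope_integral_ge: "\<phi> r / r \<le> (M - 1) * integral {0..r} (\<lambda>s. \<phi> s / s\<^sup>2)"
proof -
  have K: "((\<lambda>s. \<phi> s / s) has_real_derivative (s * \<phi>' s - \<phi> s) / s\<^sup>2) (at s)" if "s > 0" for s
    by (rule derivative_eq_intros has_derivs that refl)+
      (use that in \<open>auto simp: power2_eq_square algebra_simps\<close>)
  have cont: "isCont (\<lambda>s. \<phi> s / s\<^sup>2) s" if "s > 0" for s
    using DERIV_isCont[OF has_derivs(2)[OF that]] that by (intro continuous_intros) auto
  have pos: "\<phi> s / s\<^sup>2 > 0" if "s > 0" for s using that \<phi>_pos by simp
  have lo: "(m - 1) * (\<phi> s / s\<^sup>2) \<le> (s * \<phi>' s - \<phi> s) / s\<^sup>2" if "s > 0" for s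
    using index_bounds(1)[OF that] that by (simp add: divide_right_mono left_diff_distrib)
  have hi: "(s * \<phi>' s - \<phi> s) / s\<^sup>2 \<le> (M - 1) * (\<phi> s / s\<^sup>2)" if "s > 0" for s
    using index_bounds(2)[OF that] that by (simp add: divide_right_mono left_diff_distrib)
  show "((\<lambda>r. integral {0..r} (\<lambda>s. \<phi> s / s\<^sup>2)) has_real_derivative \<phi> r / r\<^sup>2) (at r)"
    "\<phi> r / r \<le> (M - 1) * integral {0..r} (\<lambda>s. \<phi> s / s\<^sup>2)"
    using integral_between_derivative_bounds[OF _ slope_tendsto_0 K cont pos _ lo hi assms] m_gt_1
    by auto
qed

lemma \<psi>_tendsto_0: "filterlim \<psi> (at_right 0) (at_right 0)"
proof -
  have "(\<psi> \<longlongrightarrow> 0) (at_right 0)"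
  proof (rule order_tendstoI)
    fix e :: real assume e: "e < 0"
    show "\<forall>\<^sub>F t in at_right 0. e < \<psi> t"
      using eventually_at_right_less[of 0] by eventually_elim (use e \<psi>_pos in force)
  next
    fix e :: real assume e: "0 < e"
    have "\<forall>\<^sub>F t in at_right 0. t \<in> {0<..<\<phi> e}"
      using \<phi>_pos[OF e] by (rule eventually_at_right_real)
    then show "\<forall>\<^sub>F t in at_right 0. \<psi> t < e"
      by eventually_elim (use \<psi>_strict_mono[of _ "\<phi> e"] \<psi>_\<phi>[OF e] in auto)
  qed
  moreover have "\<forall>\<^sub>F t in at_right 0. \<psi> t \<in> {0<..} \<and> \<psi> t \<noteq> 0"
    using eventually_at_right_less[of 0] by eventually_elim (use \<psi>_pos in force)
  ultimately show ?thesis by (simp add: filterlim_at)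
qed

text \<open>
  The comparison function is \<open>K t = t / \<psi> t\<close>. It tends to \<open>0\<close> at \<open>0\<close> because it equals \<open>\<phi> s / s\<close> at
  \<open>s = \<psi> t\<close>.
\<close>

lemma
  assumes "t > 0"
  shows dual_integral_deriv:
      "((\<lambda>t. integral {0..t} (\<lambda>s. 1 / \<psi> s)) has_real_derivative 1 / \<psi> t) (at t)"
    and dual_integral_ge: "t / \<psi> t \<le> (1 - 1 / M) * integral {0..t} (\<lambda>s. 1 / \<psi> s)"
proof -
  have K: "((\<lambda>t. t / \<psi> t) has_real_derivative (\<psi> t - t * \<psi>' t) / (\<psi> t)\<^sup>2) (at t)" if "t > 0" for t
    by (rule derivative_eq_intros has_derivs that refl)+
      (use \<psi>_pos[OF that] in \<open>auto simp: power2_eq_square\<close>)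
  have cont: "isCont (\<lambda>s. 1 / \<psi> s) t" if "t > 0" for t
    using DERIV_isCont[OF has_derivs(4)[OF that]] \<psi>_pos[OF that] by (intro continuous_intros) auto
  have pos: "1 / \<psi> t > 0" if "t > 0" for t using that \<psi>_pos by simp
  have K0: "((\<lambda>t. t / \<psi> t) \<longlongrightarrow> 0) (at_right 0)"
  proof (rule Lim_transform_eventually)
    show "((\<lambda>t. \<phi> (\<psi> t) / \<psi> t) \<longlongrightarrow> 0) (at_right 0)"
      by (rule filterlim_compose[OF slope_tendsto_0 \<psi>_tendsto_0])
    show "\<forall>\<^sub>F t in at_right 0. \<phi> (\<psi> t) / \<psi> t = t / \<psi> t"
      using eventually_at_right_less[of 0] by eventually_elim (simp add: \<phi>_\<psi>)
  qed
  have M: "M > 0" using m_gt_1 m_le_M by simp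
  have lo: "(1 - 1 / m) * (1 / \<psi> t) \<le> (\<psi> t - t * \<psi>' t) / (\<psi> t)\<^sup>2" if "t > 0" for t
    using dual_index_bounds(2)[OF that] \<psi>_pos[OF that] m_gt_1
    by (simp add: field_simps power2_eq_square)
  have hi: "(\<psi> t - t * \<psi>' t) / (\<psi> t)\<^sup>2 \<le> (1 - 1 / M) * (1 / \<psi> t)" if "t > 0" for t
    using dual_index_bounds(1)[OF that] \<psi>_pos[OF that] M
    by (simp add: field_simps power2_eq_square)
  show "((\<lambda>t. integral {0..t} (\<lambda>s. 1 / \<psi> s)) has_real_derivative 1 / \<psi> t) (at t)"
    "t / \<psi> t \<le> (1 - 1 / M) * integral {0..t} (\<lambda>s. 1 / \<psi> s)"
    using integral_between_derivative_bounds[OF _ K0 K cont pos _ lo hi assms] m_gt_1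
    by auto
qed

end

section \<open>Lower bounds below and above the interface\<close>

context admissible
begin

text \<open>
  The ellipticity exponent of the statement is \<open>M + 1\<close>.
\<close>

lemma ellipticity_ratio: "\<bar>1 - 2 / (M + 1)\<bar> = (M - 1) / (M + 1)"
  using m_gt_1 m_le_M by (simp add: field_simps)

lemma gap_leI:
  assumes "(M + 1) * \<bar>a - b\<bar> \<le> (M - 1) * (a + b)"
  shows "\<bar>a - b\<bar> \<le> \<bar>1 - 2 / (M + 1)\<bar> * (a + b)"
  unfolding ellipticity_ratio using assms m_gt_1 m_le_M by (simp add: field_simps)

text \<open>
  The ellipticity condition is symmetric under exchanging the radial and the tangential coefficient,
  and for \<open>\<Psi>\<close> their ratio is between \<open>1 / M\<close> and \<open>1\<close>.
\<close>

lemma dual_polar_form_lower_bound: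
  fixes B :: "complex^'n^'n"
  assumes ell: "\<And>\<xi>. \<Delta> * (norm \<xi>)\<^sup>2 \<le> (B *v \<xi>) \<bullet> (\<xi> + \<bar>1 - 2 / (M + 1)\<bar> *\<^sub>R vec_cnj \<xi>)"
    and "cmod s = 1" "t > 0" "k > 0"
  shows "\<Delta> * (k * (\<psi>' t + \<psi> t / t) / 2) * (norm z)\<^sup>2 \<le> polar_form (k * \<psi>' t) (k * \<psi> t / t) s B z"
proof -
  define \<kappa> d where "\<kappa> = \<psi> t / t" and "d = \<psi>' t"
  have pos: "\<kappa> > 0" "d > 0" using assms \<psi>_pos second_pos by (auto simp: \<kappa>_def d_def)
  have le: "d \<le> \<kappa>" "\<kappa> \<le> M * d"
    using index_ge_1(2)[OF \<open>t > 0\<close>] dual_index_bounds(1)[OF \<open>t > 0\<close>] \<open>t > 0\<close>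
    by (simp_all add: \<kappa>_def d_def field_simps)
  have "\<bar>k * d - k * \<kappa>\<bar> = k * (\<kappa> - d)"
    using mult_left_mono[OF le(1), of k] \<open>k > 0\<close> by (simp add: right_diff_distrib)
  moreover have "k * ((M + 1) * (\<kappa> - d)) \<le> k * ((M - 1) * (d + \<kappa>))"
    using le(2) \<open>k > 0\<close> by (intro mult_left_mono) (auto simp: algebra_simps)
  ultimately have "(M + 1) * \<bar>k * d - k * \<kappa>\<bar> \<le> (M - 1) * (k * d + k * \<kappa>)"
    by (simp add: distrib_left mult.left_commute)
  then have "\<bar>k * d - k * \<kappa>\<bar> \<le> \<bar>1 - 2 / (M + 1)\<bar> * (k * d + k * \<kappa>)"
    by (rule gap_leI)
  moreover have "0 \<le> k * d + k * \<kappa>" using pos assms by simp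
  ultimately have "\<Delta> * ((k * d + k * \<kappa>) / 2) * (norm z)\<^sup>2 \<le> polar_form (k * d) (k * \<kappa>) s B z"
    using polar_form_lower_bound[OF ell \<open>cmod s = 1\<close>] by blast
  then show ?thesis by (simp add: \<kappa>_def d_def distrib_left)
qed

lemma open_regions:
  "open {z :: complex \<times> complex. fst z \<noteq> 0 \<and> snd z \<noteq> 0 \<and> cmod (snd z) < \<phi> (cmod (fst z))}"
  "open {z :: complex \<times> complex. fst z \<noteq> 0 \<and> snd z \<noteq> 0 \<and> \<phi> (cmod (fst z)) < cmod (snd z)}"
proof -
  define T where "T = {z :: complex \<times> complex. fst z \<noteq> 0 \<and> snd z \<noteq> 0}"
  have T: "open T"
    unfolding T_def by (intro open_Collect_conj open_Collect_neq continuous_intros)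
  have "continuous_on {0..} \<phi>" using smooth(1) by (simp add: C1_C2_halfline_def)
  then have "continuous_on T (\<lambda>z. \<phi> (cmod (fst z)))"
    by (rule continuous_on_compose2) (auto intro!: continuous_intros)
  then have f: "continuous_on T (\<lambda>z. \<phi> (cmod (fst z)) - cmod (snd z))"
    by (intro continuous_intros)
  have "open ((\<lambda>z. \<phi> (cmod (fst z)) - cmod (snd z)) -` {0<..} \<inter> T)"
    using f unfolding continuous_on_open_vimage[OF T] by (meson open_greaterThan)
  also have "(\<lambda>z. \<phi> (cmod (fst z)) - cmod (snd z)) -` {0<..} \<inter> T
      = {z. fst z \<noteq> 0 \<and> snd z \<noteq> 0 \<and> cmod (snd z) < \<phi> (cmod (fst z))}"
    by (auto simp: T_def)
  finally show "open {z :: complex \<times> complex. fst z \<noteq> 0 \<and> snd z \<noteq> 0 \<and> cmod (snd z) < \<phi> (cmod (fst z))}" .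
  have "open ((\<lambda>z. \<phi> (cmod (fst z)) - cmod (snd z)) -` {..<0} \<inter> T)"
    using f unfolding continuous_on_open_vimage[OF T] by (meson open_lessThan)
  also have "(\<lambda>z. \<phi> (cmod (fst z)) - cmod (snd z)) -` {..<0} \<inter> T
      = {z. fst z \<noteq> 0 \<and> snd z \<noteq> 0 \<and> \<phi> (cmod (fst z)) < cmod (snd z)}"
    by (auto simp: T_def)
  finally show "open {z :: complex \<times> complex. fst z \<noteq> 0 \<and> snd z \<noteq> 0 \<and> \<phi> (cmod (fst z)) < cmod (snd z)}" .
qed

text \<open>
  Here the variables separate. With \<open>r = cmod u\<close> and \<open>t = cmod v\<close>, the form in \<open>\<zeta>\<close> has at least
  the weight \<open>q = \<phi> r / r\<close> and the form in \<open>\<eta>\<close> at least half of \<open>\<kappa> = \<psi> t / t\<close>, and these numbers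
  satisfy \<open>q * \<kappa> \<ge> 1\<close>, since \<open>1 / \<kappa>\<close> is the value of \<open>\<phi> s / s\<close> at
  \<open>s = \<psi> t < r\<close>. The summands with factor
  \<open>\<delta>\<close> contribute nonnegatively.
\<close>

lemma gen_hessian_lower_bound_below:
  fixes A B :: "complex^'n^'n"
  assumes ellA: "\<And>\<xi>. \<Delta> * (norm \<xi>)\<^sup>2 \<le> (A *v \<xi>) \<bullet> (\<xi> + \<bar>1 - 2 / (M + 1)\<bar> *\<^sub>R vec_cnj \<xi>)"
    and ellB: "\<And>\<xi>. \<Delta> * (norm \<xi>)\<^sup>2 \<le> (B *v \<xi>) \<bullet> (\<xi> + \<bar>1 - 2 / (M + 1)\<bar> *\<^sub>R vec_cnj \<xi>)"
    and \<Delta>: "\<Delta> \<ge> 0" and \<delta>: "\<delta> \<ge> 0"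
    and uv: "u \<noteq> 0" "v \<noteq> 0" "cmod v < \<phi> (cmod u)"
    and F: "\<And>x y. cmod y < \<phi> (cmod x) \<Longrightarrow> F x y = (1 + \<delta>) * (\<Phi> (cmod x) + \<Psi> (cmod y))
             + \<delta> * (cmod x)\<^sup>2 * integral {0..cmod x} (\<lambda>s. \<phi> s / s\<^sup>2)"
  shows "\<Delta> * norm \<zeta> * norm \<eta> \<le> gen_hessian A B F u v \<zeta> \<eta>"
proof -
  define r t where "r = cmod u" and "t = cmod v"
  have rt: "r > 0" "t > 0" "t < \<phi> r" using uv by (simp_all add: r_def t_def)
  define I where "I = (\<lambda>r. integral {0..r} (\<lambda>s. \<phi> s / s\<^sup>2))"
  note dI = slope_integral_deriv[folded I_def]
  define a where "a = (\<lambda>r. (1 + \<delta>) * \<Phi> r + \<delta> * (r\<^sup>2 * I r))"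
  define a1 where "a1 = (\<lambda>r. (1 + \<delta>) * \<phi> r + \<delta> * (2 * r * I r + \<phi> r))"
  define a2 where "a2 = (\<lambda>r. (1 + \<delta>) * \<phi>' r + \<delta> * (2 * I r + 2 * (\<phi> r / r) + \<phi>' r))"
  have a: "(a has_real_derivative a1 r) (at r)" if "r > 0" for r
    unfolding a_def a1_def
    by (rule derivative_eq_intros has_derivs(1)[OF that] dI[OF that] refl)+
      (use that in \<open>simp add: field_simps power2_eq_square\<close>)
  have a1: "(a1 has_real_derivative a2 r) (at r)" if "r > 0" for r
    unfolding a1_def a2_def
    by (rule derivative_eq_intros has_derivs(2)[OF that] dI[OF that] refl)+
      (use that in \<open>simp add: field_simps power2_eq_square\<close>)
  define S where "S = {z :: complex \<times> complex. fst z \<noteq> 0 \<and> snd z \<noteq> 0 \<and> cmod (snd z) < \<phi> (cmod (fst z))}"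
  have "open S" unfolding S_def by (rule open_regions(1))
  have H: "gen_hessian A B F u v \<zeta> \<eta>
      = polar_form (a2 r) (a1 r / r) (sgn u) A \<zeta>
        + polar_form ((1 + \<delta>) * \<psi>' t) ((1 + \<delta>) * \<psi> t / t) (sgn v) B \<eta>"
  proof -
    have b: "((\<lambda>t. (1 + \<delta>) * \<Psi> t) has_real_derivative (1 + \<delta>) * \<psi> t) (at t)"
      "((\<lambda>t. (1 + \<delta>) * \<psi> t) has_real_derivative (1 + \<delta>) * \<psi>' t) (at t)" if "t > 0" for t
      using that by (intro DERIV_cmult has_derivs; simp)+
    define g :: "real \<Rightarrow> real" where "g = (\<lambda>_. 0)"
    have g: "(g has_real_derivative g t) (at t)" for t by (simp add: g_def)
    have "F x y = a (cmod x) + (1 + \<delta>) * \<Psi> (cmod y) + 0 * (cmod x)\<^sup>2 * g (cmod y)"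
      if "(x, y) \<in> S" for x y
      using that F[of y x] by (simp add: S_def a_def I_def algebra_simps)
    moreover have "(u, v) \<in> S" "S \<subseteq> {(x, y). x \<noteq> 0 \<and> y \<noteq> 0}"
      using uv by (auto simp: S_def)
    ultimately show ?thesis
      using gen_hessian_biradial[OF a a1 b g g \<open>open S\<close>, of u v F 0 A B \<zeta> \<eta>]
      by (simp add: r_def t_def)
  qed
  define q \<kappa> where "q = \<phi> r / r" and "\<kappa> = \<psi> t / t"
  have q: "q > 0" and \<kappa>: "\<kappa> > 0" using \<phi>_pos \<psi>_pos rt by (simp_all add: q_def \<kappa>_def)
  have \<phi>': "q \<le> \<phi>' r" "\<phi>' r \<le> M * q"
    using index_ge_1(1)[OF rt(1)] index_bounds(2)[OF rt(1)] rt(1) by (simp_all add: q_def field_simps)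
  have I: "q \<le> (M - 1) * I r" using slope_integral_ge[OF rt(1)] by (simp add: q_def I_def)
  have M: "M > 1" using m_gt_1 m_le_M by simp
  then have I0: "I r > 0" using I q zero_less_mult_pos[of "M - 1" "I r"] by linarith
  have sum: "a2 r + a1 r / r = (1 + \<delta>) * (\<phi>' r + q) + \<delta> * (4 * I r + 3 * q + \<phi>' r)"
    and diff: "a2 r - a1 r / r = (1 + \<delta>) * (\<phi>' r - q) + \<delta> * (q + \<phi>' r)"
    using rt(1) by (simp_all add: a1_def a2_def q_def field_simps)
  have sum_ge: "2 * q \<le> a2 r + a1 r / r"
  proof -
    have "2 * q + 0 \<le> (\<phi>' r + q) + (\<delta> * (\<phi>' r + q) + \<delta> * (4 * I r + 3 * q + \<phi>' r))"
      using \<phi>' q I0 \<delta> by (intro add_mono add_nonneg_nonneg mult_nonneg_nonneg) auto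
    then show ?thesis by (simp add: sum distrib_right)
  qed
  \<comment> \<open>The two groups of terms are treated separately: the one without the integral uses
      \<open>\<phi>' r \<le> M * q\<close>, the one with it uses also \<open>q \<le> (M - 1) * I r\<close>.\<close>
  have "\<bar>a2 r - a1 r / r\<bar> \<le> \<bar>1 - 2 / (M + 1)\<bar> * (a2 r + a1 r / r)"
  proof (rule gap_leI)
    have "0 \<le> a2 r - a1 r / r"
      unfolding diff using \<phi>' q \<delta> by (intro add_nonneg_nonneg mult_nonneg_nonneg) auto
    moreover have "(1 + \<delta>) * ((M + 1) * (\<phi>' r - q)) \<le> (1 + \<delta>) * ((M - 1) * (\<phi>' r + q))"
      using \<phi>' \<delta> by (intro mult_left_mono) (auto simp: algebra_simps)
    moreover have "\<delta> * ((M + 1) * (q + \<phi>' r)) \<le> \<delta> * ((M - 1) * (4 * I r + 3 * q + \<phi>' r))"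
      using \<phi>' I \<delta> by (intro mult_left_mono) (auto simp: algebra_simps)
    moreover have "(M + 1) * (a2 r - a1 r / r)
        = (1 + \<delta>) * ((M + 1) * (\<phi>' r - q)) + \<delta> * ((M + 1) * (q + \<phi>' r))"
      unfolding diff by (simp add: algebra_simps)
    moreover have "(M - 1) * (a2 r + a1 r / r)
        = (1 + \<delta>) * ((M - 1) * (\<phi>' r + q)) + \<delta> * ((M - 1) * (4 * I r + 3 * q + \<phi>' r))"
      unfolding sum by (simp add: algebra_simps)
    ultimately show "(M + 1) * \<bar>a2 r - a1 r / r\<bar> \<le> (M - 1) * (a2 r + a1 r / r)" by simp
  qed
  then have "\<Delta> * ((a2 r + a1 r / r) / 2) * (norm \<zeta>)\<^sup>2 \<le> polar_form (a2 r) (a1 r / r) (sgn u) A \<zeta>"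
    using sum_ge q uv by (intro polar_form_lower_bound[OF ellA]) (auto simp: norm_sgn)
  moreover have "\<Delta> * q * (norm \<zeta>)\<^sup>2 \<le> \<Delta> * ((a2 r + a1 r / r) / 2) * (norm \<zeta>)\<^sup>2"
    using sum_ge \<Delta> by (intro mult_right_mono mult_left_mono) auto
  moreover have "\<Delta> * ((1 + \<delta>) * (\<psi>' t + \<kappa>) / 2) * (norm \<eta>)\<^sup>2
      \<le> polar_form ((1 + \<delta>) * \<psi>' t) ((1 + \<delta>) * \<psi> t / t) (sgn v) B \<eta>"
    unfolding \<kappa>_def
    by (rule dual_polar_form_lower_bound[OF ellB]) (use rt uv \<delta> in \<open>auto simp: norm_sgn\<close>)
  moreover have "\<Delta> * (\<kappa> / 2) * (norm \<eta>)\<^sup>2 \<le> \<Delta> * ((1 + \<delta>) * (\<psi>' t + \<kappa>) / 2) * (norm \<eta>)\<^sup>2"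
  proof -
    have "1 * \<kappa> \<le> (1 + \<delta>) * (\<psi>' t + \<kappa>)"
      using \<delta> \<kappa> second_pos(2)[OF rt(2)] by (intro mult_mono) auto
    then show ?thesis using \<Delta> by (intro mult_right_mono mult_left_mono) auto
  qed
  ultimately have "\<Delta> * (q * (norm \<zeta>)\<^sup>2 + \<kappa> / 2 * (norm \<eta>)\<^sup>2) \<le> gen_hessian A B F u v \<zeta> \<eta>"
    unfolding H by (simp add: algebra_simps)
  moreover have "\<Delta> * (norm \<zeta> * norm \<eta>) \<le> \<Delta> * (q * (norm \<zeta>)\<^sup>2 + \<kappa> / 2 * (norm \<eta>)\<^sup>2)"
  proof (rule mult_left_mono[OF _ \<Delta>])
    have "\<psi> t < r"
      using \<psi>_strict_mono[OF rt(2,3)] \<psi>_\<phi>[OF rt(1)] by simp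
    then have "1 / \<kappa> \<le> q"
      using slope_mono[of "\<psi> t" r] \<psi>_pos[OF rt(2)] by (simp add: q_def \<kappa>_def \<phi>_\<psi>[OF rt(2)])
    then have "1 / q \<le> \<kappa>" using q \<kappa> by (simp add: field_simps)
    then have "1 / q / 2 * (norm \<eta>)\<^sup>2 \<le> \<kappa> / 2 * (norm \<eta>)\<^sup>2" by (intro mult_right_mono) auto
    moreover have "norm \<zeta> * norm \<eta> \<le> q * (norm \<zeta>)\<^sup>2 + 1 / q / 2 * (norm \<eta>)\<^sup>2"
    proof -
      have "0 \<le> (q * norm \<zeta> - norm \<eta> / 2)\<^sup>2 / q + (norm \<eta>)\<^sup>2 / (4 * q)" using q by simp
      also have "\<dots> = q * (norm \<zeta>)\<^sup>2 + 1 / q / 2 * (norm \<eta>)\<^sup>2 - norm \<zeta> * norm \<eta>"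
        using q by (simp add: field_simps power2_eq_square)
      finally show ?thesis by simp
    qed
    ultimately show "norm \<zeta> * norm \<eta> \<le> q * (norm \<zeta>)\<^sup>2 + \<kappa> / 2 * (norm \<eta>)\<^sup>2" by linarith
  qed
  ultimately show ?thesis by (simp add: mult.assoc)
qed

text \<open>
  Write \<open>r = cmod u\<close> and \<open>t = cmod v\<close>. The form of \<open>\<Phi>\<close> in \<open>\<zeta>\<close> is nonnegative. The gain in \<open>\<zeta>\<close> is \<open>2 * \<delta> * l * g t\<close> with
  \<open>g t \<ge> M / (M - 1) / \<kappa>\<close>, and \<open>\<Psi>\<close> gives \<open>\<eta>\<close> the weight \<open>\<Delta>B * (d + \<kappa>) / 2\<close>, where \<open>\<kappa> = \<psi> t / t\<close> and
  \<open>d = \<psi>' t\<close>. The form of \<open>g\<close> in \<open>\<eta>\<close> and the cross terms contain \<open>r / \<psi> t\<close>, which is at most \<open>1\<close>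
  above the interface; the former costs at most half of the weight in \<open>\<eta>\<close>. The inequality of the
  means applied to \<open>\<alpha> = 2 * \<delta> * l * M / (M - 1) / \<kappa>\<close> and \<open>\<beta> = \<Delta>B * \<kappa> / 4\<close> eliminates \<open>\<kappa>\<close>.
\<close>

lemma gen_hessian_lower_bound_above:
  fixes A B :: "complex^'n^'n"
  assumes ellA: "\<And>\<xi>. \<Delta>A * (norm \<xi>)\<^sup>2 \<le> (A *v \<xi>) \<bullet> (\<xi> + \<bar>1 - 2 / (M + 1)\<bar> *\<^sub>R vec_cnj \<xi>)"
    and ellB: "\<And>\<xi>. \<Delta>B * (norm \<xi>)\<^sup>2 \<le> (B *v \<xi>) \<bullet> (\<xi> + \<bar>1 - 2 / (M + 1)\<bar> *\<^sub>R vec_cnj \<xi>)"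
    and lowA: "\<And>\<xi>. l * (norm \<xi>)\<^sup>2 \<le> (A *v \<xi>) \<bullet> \<xi>"
    and bdA: "\<And>\<xi> \<omega>. \<bar>(A *v \<xi>) \<bullet> \<omega>\<bar> \<le> LA * norm \<xi> * norm \<omega>"
    and bdB: "\<And>\<xi> \<omega>. \<bar>(B *v \<xi>) \<bullet> \<omega>\<bar> \<le> LB * norm \<xi> * norm \<omega>"
    and nonneg: "\<Delta>A \<ge> 0" "\<Delta>B \<ge> 0" "l \<ge> 0" "LA \<ge> 0" "LB \<ge> 0" "\<delta> \<ge> 0"
    and small: "4 * (\<delta> * LB) \<le> \<Delta>B"
    and uv: "u \<noteq> 0" "v \<noteq> 0" "\<phi> (cmod u) < cmod v"
    and F: "\<And>x y. \<phi> (cmod x) < cmod y \<Longrightarrow> F x y = \<Phi> (cmod x) + \<Psi> (cmod y)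
             + \<delta> * (cmod x)\<^sup>2 * integral {0..cmod y} (\<lambda>s. 1 / \<psi> s)"
  shows "(sqrt (2 * (\<delta> * l * \<Delta>B * (M / (M - 1)))) - 2 * \<delta> * (LA + LB)) * norm \<zeta> * norm \<eta>
    \<le> gen_hessian A B F u v \<zeta> \<eta>"
proof -
  define r t where "r = cmod u" and "t = cmod v"
  have rt: "r > 0" "t > 0" "\<phi> r < t" using uv by (simp_all add: r_def t_def)
  have unit: "cmod (sgn u) = 1" "cmod (sgn v) = 1" using uv by (simp_all add: norm_sgn)
  have M: "M > 1" using m_gt_1 m_le_M by simp
  define g where "g = (\<lambda>t. integral {0..t} (\<lambda>s. 1 / \<psi> s))"
  have g1: "((\<lambda>t. 1 / \<psi> t) has_real_derivative - \<psi>' t / (\<psi> t)\<^sup>2) (at t)" if "t > 0" for t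
    by (rule derivative_eq_intros has_derivs(4)[OF that] refl)+
      (use \<psi>_pos[OF that] in \<open>auto simp: power2_eq_square\<close>)
  define S where "S = {z :: complex \<times> complex. fst z \<noteq> 0 \<and> snd z \<noteq> 0 \<and> \<phi> (cmod (fst z)) < cmod (snd z)}"
  have "open S" unfolding S_def by (rule open_regions(2))
  define \<kappa> d where "\<kappa> = \<psi> t / t" and "d = \<psi>' t"
  have \<kappa>: "\<kappa> > 0" and d: "d > 0" using \<psi>_pos second_pos rt by (simp_all add: \<kappa>_def d_def)
  define X Y where "X = norm \<zeta>" and "Y = norm \<eta>"
  have XY: "X \<ge> 0" "Y \<ge> 0" by (simp_all add: X_def Y_def)
  define HB where "HB = polar_form (- d / (\<psi> t)\<^sup>2) (1 / \<psi> t / t) (sgn v) B \<eta>"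
  define C1 where "C1 = (\<Sum>k\<in>UNIV. (sgn v \<bullet> (B *v \<eta>) $ k) * (sgn u \<bullet> \<zeta> $ k))"
  define C2 where "C2 = (\<Sum>k\<in>UNIV. (sgn u \<bullet> (A *v \<zeta>) $ k) * (sgn v \<bullet> \<eta> $ k))"
  have H: "gen_hessian A B F u v \<zeta> \<eta>
      = polar_form (\<phi>' r) (\<phi> r / r) (sgn u) A \<zeta> + polar_form d \<kappa> (sgn v) B \<eta>
        + \<delta> * (2 * g t * ((A *v \<zeta>) \<bullet> \<zeta>) + r\<^sup>2 * HB + 2 * r * (1 / \<psi> t) * (C1 + C2))"
  proof -
    have g: "(g has_real_derivative 1 / \<psi> t) (at t)" if "t > 0" for t
      unfolding g_def by (rule dual_integral_deriv[OF that])
    have "F x y = \<Phi> (cmod x) + \<Psi> (cmod y) + \<delta> * (cmod x)\<^sup>2 * g (cmod y)"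
      if "(x, y) \<in> S" for x y
      using that F[of x y] by (simp add: S_def g_def)
    moreover have "(u, v) \<in> S" "S \<subseteq> {(x, y). x \<noteq> 0 \<and> y \<noteq> 0}"
      using uv by (auto simp: S_def)
    ultimately show ?thesis
      using gen_hessian_biradial[OF has_derivs g g1 \<open>open S\<close>, of u v F \<delta> A B \<zeta> \<eta>]
      by (simp add: r_def t_def \<kappa>_def d_def HB_def C1_def C2_def)
  qed
  have "r \<le> \<psi> t"
    using \<psi>_strict_mono[OF \<phi>_pos[OF rt(1)] rt(3)] \<psi>_\<phi>[OF rt(1)] by simp
  then have ratio: "0 \<le> r / \<psi> t" "r / \<psi> t \<le> 1" using rt \<psi>_pos[OF rt(2)] by simp_all
  have uu: "0 \<le> polar_form (\<phi>' r) (\<phi> r / r) (sgn u) A \<zeta>"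
  proof -
    define q where "q = \<phi> r / r"
    have q: "q > 0" "q \<le> \<phi>' r" "\<phi>' r \<le> M * q"
      using \<phi>_pos[OF rt(1)] index_ge_1(1)[OF rt(1)] index_bounds(2)[OF rt(1)] rt(1)
      by (simp_all add: q_def field_simps)
    have "\<bar>\<phi>' r - q\<bar> \<le> \<bar>1 - 2 / (M + 1)\<bar> * (\<phi>' r + q)"
      by (rule gap_leI) (use q in \<open>simp add: algebra_simps\<close>)
    from polar_form_lower_bound[OF ellA unit(1) _ this, of \<zeta>]
    have "\<Delta>A * ((\<phi>' r + q) / 2) * (norm \<zeta>)\<^sup>2 \<le> polar_form (\<phi>' r) q (sgn u) A \<zeta>"
      using q by simp
    moreover have "0 \<le> \<Delta>A * ((\<phi>' r + q) / 2) * (norm \<zeta>)\<^sup>2" using q nonneg by simp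
    ultimately show ?thesis by (simp add: q_def)
  qed
  have g_ge: "M / (M - 1) / \<kappa> \<le> g t"
  proof -
    have "1 / \<kappa> \<le> (1 - 1 / M) * g t"
      using dual_integral_ge[OF rt(2)] by (simp add: \<kappa>_def g_def)
    then have "M / (M - 1) * (1 / \<kappa>) \<le> M / (M - 1) * ((1 - 1 / M) * g t)"
      by (rule mult_left_mono) (use M in simp)
    also have "\<dots> = g t" using M by (simp add: field_simps)
    finally show ?thesis by simp
  qed
  have uu': "2 * (M / (M - 1) / \<kappa>) * (l * X\<^sup>2) \<le> 2 * g t * ((A *v \<zeta>) \<bullet> \<zeta>)"
    using g_ge lowA[of \<zeta>] nonneg M \<kappa>
    by (intro mult_mono) (auto simp: X_def intro: order_trans[OF _ g_ge])
  have vv: "- (LB * (d + \<kappa>) * Y\<^sup>2) \<le> r\<^sup>2 * HB"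
  proof -
    have "\<bar>HB\<bar> \<le> LB * (\<bar>- d / (\<psi> t)\<^sup>2\<bar> + \<bar>1 / \<psi> t / t\<bar>) * Y\<^sup>2"
      unfolding HB_def Y_def by (rule abs_polar_form_le[OF bdB unit(2) nonneg(5)])
    also have "\<bar>- d / (\<psi> t)\<^sup>2\<bar> + \<bar>1 / \<psi> t / t\<bar> = (d + \<kappa>) / (\<psi> t)\<^sup>2"
      using d rt \<psi>_pos[OF rt(2)] by (simp add: \<kappa>_def power2_eq_square field_simps)
    finally have "r\<^sup>2 * \<bar>HB\<bar> \<le> r\<^sup>2 * (LB * ((d + \<kappa>) / (\<psi> t)\<^sup>2) * Y\<^sup>2)"
      by (rule mult_left_mono) simp
    also have "\<dots> = (r / \<psi> t)\<^sup>2 * (LB * (d + \<kappa>) * Y\<^sup>2)" by (simp add: power_divide)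
    also have "\<dots> \<le> 1 * (LB * (d + \<kappa>) * Y\<^sup>2)"
      using ratio nonneg d \<kappa> by (intro mult_right_mono power_le_one) auto
    finally have "r\<^sup>2 * \<bar>HB\<bar> \<le> LB * (d + \<kappa>) * Y\<^sup>2" by simp
    moreover have "r\<^sup>2 * - \<bar>HB\<bar> \<le> r\<^sup>2 * HB" by (intro mult_left_mono) auto
    ultimately show ?thesis by simp
  qed
  have cross: "- (2 * (LA + LB) * X * Y) \<le> 2 * r * (1 / \<psi> t) * (C1 + C2)"
  proof -
    have "\<bar>C1\<bar> \<le> LB * Y * X" "\<bar>C2\<bar> \<le> LA * X * Y"
      unfolding C1_def C2_def X_def Y_def using unit nonneg bdA bdB
      by (intro abs_cross_term_le; blast)+
    then have "\<bar>C1 + C2\<bar> \<le> (LA + LB) * X * Y" by (simp add: algebra_simps)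
    then have "(r / \<psi> t) * \<bar>C1 + C2\<bar> \<le> 1 * ((LA + LB) * X * Y)"
      using ratio by (intro mult_mono) auto
    moreover have "(r / \<psi> t) * - \<bar>C1 + C2\<bar> \<le> (r / \<psi> t) * (C1 + C2)"
      using ratio by (intro mult_left_mono) auto
    moreover have "2 * r * (1 / \<psi> t) * (C1 + C2) = 2 * ((r / \<psi> t) * (C1 + C2))" by simp
    moreover have "2 * (LA + LB) * X * Y = 2 * ((LA + LB) * X * Y)" by simp
    ultimately show ?thesis by linarith
  qed
  have BB: "\<Delta>B * ((d + \<kappa>) / 2) * Y\<^sup>2 \<le> polar_form d \<kappa> (sgn v) B \<eta>"
    using dual_polar_form_lower_bound[OF ellB unit(2) rt(2), of 1 \<eta>]
    by (simp add: \<kappa>_def d_def Y_def)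
  have "\<delta> * (2 * (M / (M - 1) / \<kappa>) * (l * X\<^sup>2) - LB * (d + \<kappa>) * Y\<^sup>2 - 2 * (LA + LB) * X * Y)
      \<le> \<delta> * (2 * g t * ((A *v \<zeta>) \<bullet> \<zeta>) + r\<^sup>2 * HB + 2 * r * (1 / \<psi> t) * (C1 + C2))"
    using uu' vv cross by (intro mult_left_mono nonneg(6)) linarith
  then have "\<Delta>B * ((d + \<kappa>) / 2) * Y\<^sup>2
      + \<delta> * (2 * (M / (M - 1) / \<kappa>) * (l * X\<^sup>2) - LB * (d + \<kappa>) * Y\<^sup>2 - 2 * (LA + LB) * X * Y)
      \<le> gen_hessian A B F u v \<zeta> \<eta>"
    unfolding H using uu BB by linarith
  moreover have "\<delta> * (LB * (d + \<kappa>) * Y\<^sup>2) \<le> \<Delta>B * ((d + \<kappa>) / 4) * Y\<^sup>2"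
    using mult_right_mono[OF small, of "(d + \<kappa>) * Y\<^sup>2"] d \<kappa> by (simp add: algebra_simps)
  moreover have "\<Delta>B * (\<kappa> / 4) * Y\<^sup>2 \<le> \<Delta>B * ((d + \<kappa>) / 4) * Y\<^sup>2"
    using nonneg d by (intro mult_right_mono mult_left_mono) auto
  moreover define \<alpha> \<beta> where "\<alpha> = 2 * \<delta> * l * (M / (M - 1)) / \<kappa>" and "\<beta> = \<Delta>B * \<kappa> / 4"
  moreover have "\<delta> * (2 * (M / (M - 1) / \<kappa>) * (l * X\<^sup>2) - LB * (d + \<kappa>) * Y\<^sup>2 - 2 * (LA + LB) * X * Y)
      = \<alpha> * X\<^sup>2 - \<delta> * (LB * (d + \<kappa>) * Y\<^sup>2) - 2 * \<delta> * (LA + LB) * X * Y"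
  proof -
    have "\<delta> * (2 * (N / \<kappa>) * (l * x) - b - 2 * c * X * Y) = 2 * \<delta> * l * N / \<kappa> * x - \<delta> * b - 2 * \<delta> * c * X * Y"
      for N x b c by (simp add: algebra_simps)
    then show ?thesis by (simp only: \<alpha>_def)
  qed
  moreover have "\<Delta>B * (\<kappa> / 4) * Y\<^sup>2 = \<beta> * Y\<^sup>2" by (simp add: \<beta>_def)
  moreover have "\<Delta>B * ((d + \<kappa>) / 2) * Y\<^sup>2 = 2 * (\<Delta>B * ((d + \<kappa>) / 4) * Y\<^sup>2)" by simp
  ultimately have main: "\<alpha> * X\<^sup>2 + \<beta> * Y\<^sup>2 - 2 * \<delta> * (LA + LB) * X * Y \<le> gen_hessian A B F u v \<zeta> \<eta>"
    by linarith
  have \<alpha>\<beta>: "\<alpha> \<ge> 0" "\<beta> \<ge> 0" using nonneg M \<kappa> by (simp_all add: \<alpha>_def \<beta>_def)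
  have "sqrt (2 * (\<delta> * l * \<Delta>B * (M / (M - 1)))) = 2 * (sqrt \<alpha> * sqrt \<beta>)"
  proof -
    have "2 * (\<delta> * l * \<Delta>B * N) = 2\<^sup>2 * (2 * \<delta> * l * N / \<kappa> * (\<Delta>B * \<kappa> / 4))" for N
      using \<kappa> by simp
    then have "2 * (\<delta> * l * \<Delta>B * (M / (M - 1))) = 2\<^sup>2 * (\<alpha> * \<beta>)"
      unfolding \<alpha>_def \<beta>_def .
    then show ?thesis by (simp add: real_sqrt_mult)
  qed
  moreover have "2 * (sqrt \<alpha> * sqrt \<beta>) * X * Y \<le> \<alpha> * X\<^sup>2 + \<beta> * Y\<^sup>2"
  proof -
    have "0 \<le> (sqrt \<alpha> * X - sqrt \<beta> * Y)\<^sup>2" by simp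
    also have "\<dots> = \<alpha> * X\<^sup>2 + \<beta> * Y\<^sup>2 - 2 * (sqrt \<alpha> * sqrt \<beta>) * X * Y"
      using \<alpha>\<beta> by (simp add: power2_diff power_mult_distrib mult_ac)
    finally show ?thesis by simp
  qed
  ultimately show ?thesis
    using main by (simp add: X_def Y_def left_diff_distrib)
qed

end

section \<open>Essential bounds and the choice of the constant\<close>

text \<open>
  The value \<open>- \<infinity>\<close> is harmless: then the inequality \<open>ereal (f x) \<le> - \<infinity>\<close> would hold almost everywhere,
  so almost every point satisfies anything.
\<close>

lemma AE_le_esssup_real:
  fixes f :: "'a \<Rightarrow> real"
  assumes "esssup N (\<lambda>x. ereal (f x)) < \<infinity>"
  shows "AE x in N. f x \<le> real_of_ereal (esssup N (\<lambda>x. ereal (f x)))"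
proof -
  have "AE x in N. ereal (f x) \<le> esssup N (\<lambda>x. ereal (f x))" by (rule esssup_AE)
  then show ?thesis
    by eventually_elim (use assms in \<open>cases "esssup N (\<lambda>x. ereal (f x))"; simp\<close>)
qed

text \<open>
  A positive essential infimum of a real-valued function is finite, since Lebesgue measure does not
  vanish; hence its real value is positive as well.
\<close>

lemma essinf_real_le_AE:
  fixes f :: "real^'n \<Rightarrow> real"
  assumes "essinf lebesgue (\<lambda>x. ereal (f x)) > 0"
  shows "AE x in lebesgue. real_of_ereal (essinf lebesgue (\<lambda>x. ereal (f x))) \<le> f x"
    and "real_of_ereal (essinf lebesgue (\<lambda>x. ereal (f x))) > 0"
proof -
  define E where "E = esssup lebesgue (\<lambda>x. - ereal (f x))"
  have E: "essinf lebesgue (\<lambda>x. ereal (f x)) = - E" by (simp add: essinf_def E_def)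
  have ae: "AE x in lebesgue. - ereal (f x) \<le> E" unfolding E_def by (rule esssup_AE)
  have "E \<noteq> - \<infinity>"
  proof
    assume "E = - \<infinity>"
    then have "AE x in (lebesgue :: (real^'n) measure). False" using ae by simp
    then have "emeasure lebesgue (UNIV :: (real^'n) set) = 0"
      by (subst (asm) AE_iff_measurable[where N = UNIV]) auto
    then show False by simp
  qed
  moreover have "E < 0" using assms unfolding E by simp
  ultimately obtain e where e: "E = ereal e" "e < 0" by (cases E) auto
  show "real_of_ereal (essinf lebesgue (\<lambda>x. ereal (f x))) > 0" unfolding E using e by simp
  show "AE x in lebesgue. real_of_ereal (essinf lebesgue (\<lambda>x. ereal (f x))) \<le> f x"
    unfolding E using ae by eventually_elim (use e in simp)
qed

lemma matrix_vector_mult_scaleR_complex: "(M :: complex^'n^'n) *v (c *\<^sub>R x) = c *\<^sub>R (M *v x)"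
  by (rule linear_scale[OF bounded_linear.linear[OF matrix_vector_mul_bounded_linear]])

lemma cmod_cinner_le: "cmod (cinner x y) \<le> CARD('n) * (norm x * norm y)" for x y :: "complex^'n"
proof -
  have "cmod (cinner x y) \<le> (\<Sum>i\<in>UNIV. norm (x $ i) * norm (y $ i))"
    unfolding cinner_def by (rule order_trans[OF norm_sum]) (simp add: norm_mult)
  also have "\<dots> \<le> (\<Sum>i\<in>(UNIV :: 'n set). norm x * norm y)"
    by (intro sum_mono mult_mono Finite_Cartesian_Product.norm_nth_le) auto
  finally show ?thesis by simp
qed

text \<open>
  Homogeneity reduces the bound to unit vectors; that the supremum is over a bounded set has to be
  checked because an unbounded one would have an unspecified value.
\<close>

lemma abs_inner_le_of_SUP:
  fixes M :: "complex^'n^'n"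
  assumes "(SUP (\<zeta>, \<eta>)\<in>sphere 0 1 \<times> sphere 0 1. cmod (cinner (M *v \<zeta>) \<eta>)) \<le> L"
  shows "\<bar>(M *v \<xi>) \<bullet> \<omega>\<bar> \<le> L * norm \<xi> * norm \<omega>"
proof (cases "\<xi> = 0 \<or> \<omega> = 0")
  case True
  then show ?thesis by auto
next
  case False
  have bdd: "bdd_above ((\<lambda>(\<zeta>, \<eta>). cmod (cinner (M *v \<zeta>) \<eta>)) ` (sphere 0 1 \<times> sphere 0 1))"
  proof (rule bdd_aboveI2)
    fix z :: "(complex^'n) \<times> (complex^'n)" assume z: "z \<in> sphere 0 1 \<times> sphere 0 1"
    have "cmod (cinner (M *v fst z) (snd z)) \<le> CARD('n) * (norm (M *v fst z) * norm (snd z))"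
      by (rule cmod_cinner_le)
    also have "\<dots> \<le> CARD('n) * onorm ((*v) M)"
      using onorm[OF matrix_vector_mul_bounded_linear, of M "fst z"] z
      by (intro mult_left_mono) auto
    finally show "(\<lambda>(\<zeta>, \<eta>). cmod (cinner (M *v \<zeta>) \<eta>)) z \<le> CARD('n) * onorm ((*v) M)"
      by (simp add: case_prod_unfold)
  qed
  have "\<bar>(M *v sgn \<xi>) \<bullet> sgn \<omega>\<bar> \<le> cmod (cinner (M *v sgn \<xi>) (sgn \<omega>))"
    unfolding Re_cinner[symmetric] by (rule abs_Re_le_cmod)
  also have "\<dots> \<le> (SUP (\<zeta>, \<eta>)\<in>sphere 0 1 \<times> sphere 0 1. cmod (cinner (M *v \<zeta>) \<eta>))"
    using cSUP_upper[OF _ bdd, of "(sgn \<xi>, sgn \<omega>)"] False by (simp add: norm_sgn)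
  finally have "\<bar>(M *v sgn \<xi>) \<bullet> sgn \<omega>\<bar> \<le> L" using assms by simp
  then show ?thesis
    using False by (simp add: sgn_div_norm matrix_vector_mult_scaleR_complex abs_mult field_simps)
qed

text \<open>
  For \<open>\<sigma> = 0\<close> this covers the ellipticity constant \<open>\<lambda>\<close>, for \<open>\<sigma> = \<bar>1 - 2 / p\<bar>\<close> the constant \<open>\<Delta>\<^sub>p\<close>.
\<close>

lemma twisted_form_ge_of_INF:
  fixes M :: "complex^'n^'n"
  assumes "l \<le> (INF \<xi>\<in>sphere 0 1. Re (cinner (M *v \<xi>) (\<xi> + \<sigma> *\<^sub>R vec_cnj \<xi>)))"
  shows "l * (norm \<xi>)\<^sup>2 \<le> (M *v \<xi>) \<bullet> (\<xi> + \<sigma> *\<^sub>R vec_cnj \<xi>)"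
proof (cases "\<xi> = 0")
  case True
  then show ?thesis by simp
next
  case False
  let ?q = "\<lambda>\<xi>. (M *v \<xi>) \<bullet> (\<xi> + \<sigma> *\<^sub>R vec_cnj \<xi>)"
  have bdd: "bdd_below (?q ` sphere 0 1)"
  proof (rule bdd_belowI2)
    fix z :: "complex^'n" assume z: "z \<in> sphere 0 1"
    have "\<bar>?q z\<bar> \<le> norm (M *v z) * norm (z + \<sigma> *\<^sub>R vec_cnj z)" by (rule Cauchy_Schwarz_ineq2)
    also have "\<dots> \<le> onorm ((*v) M) * (1 + \<bar>\<sigma>\<bar>)"
      using onorm[OF matrix_vector_mul_bounded_linear, of M z] z
        norm_triangle_ineq[of z "\<sigma> *\<^sub>R vec_cnj z"]
      by (intro mult_mono) (auto intro: onorm_pos_le)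
    finally show "- (onorm ((*v) M) * (1 + \<bar>\<sigma>\<bar>)) \<le> ?q z" by linarith
  qed
  have "l \<le> ?q (sgn \<xi>)"
    using assms cINF_lower[OF bdd, of "sgn \<xi>"] False by (simp add: Re_cinner norm_sgn)
  moreover have "?q (sgn \<xi>) = ?q \<xi> / (norm \<xi>)\<^sup>2"
  proof -
    have "vec_cnj (sgn \<xi>) = (1 / norm \<xi>) *\<^sub>R vec_cnj \<xi>"
      by (simp add: vec_cnj_def sgn_div_norm vec_eq_iff divide_inverse)
    then have "sgn \<xi> + \<sigma> *\<^sub>R vec_cnj (sgn \<xi>) = (1 / norm \<xi>) *\<^sub>R (\<xi> + \<sigma> *\<^sub>R vec_cnj \<xi>)"
      by (simp add: sgn_div_norm scaleR_add_right divide_inverse mult.commute)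
    moreover have "M *v sgn \<xi> = (1 / norm \<xi>) *\<^sub>R (M *v \<xi>)"
      by (simp add: sgn_div_norm matrix_vector_mult_scaleR_complex divide_inverse)
    ultimately show ?thesis by (simp add: power2_eq_square divide_inverse)
  qed
  ultimately show ?thesis using False by (simp add: field_simps)
qed

text \<open>
  The arithmetic behind the choice of \<open>\<delta>\<close>. With \<open>Q = \<delta> * lA * \<Delta>B * M / (M - 1)\<close> the gain above the
  interface is \<open>sqrt (2 * Q)\<close>. The third entry of the minimum makes the cross terms at most
  \<open>4 * \<delta> * L \<le> 0.4 * sqrt Q\<close> with \<open>L = max LA LB\<close>, and \<open>sqrt 2 - 0.4 \<ge> 1\<close> leaves \<open>sqrt Q\<close>. Conversely
  every entry of the minimum is at least \<open>D * l / (100 * L\<^sup>2)\<close>, with \<open>D\<close> the smaller of the two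
  \<open>\<Delta>\<close> and \<open>l\<close> the smaller of the two \<open>\<lambda>\<close>, so that \<open>sqrt Q\<close> dominates the constant of the statement.
\<close>

lemma bellman_constant_bounds:
  fixes LA LB lA lB \<Delta>A \<Delta>B m M :: real
  assumes pos: "\<Delta>A > 0" "\<Delta>B > 0" "lA > 0" "lB > 0" and le: "lA \<le> LA" "lB \<le> LB"
    and mM: "1 < m" "m \<le> M"
  defines "\<delta> \<equiv> (m - 1) / m * Min {\<Delta>A / (8 * LA), \<Delta>B / (4 * LB), lA * \<Delta>B / (100 * max (LA\<^sup>2) (LB\<^sup>2))}"
    and "T \<equiv> 1 / 10 * sqrt (M / m * ((m - 1) / (M - 1))) * inverse (max LA LB / (min \<Delta>A \<Delta>B * min lA lB))"
  shows "T \<le> min \<Delta>A \<Delta>B"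
    and "T \<le> sqrt (2 * (\<delta> * lA * \<Delta>B * (M / (M - 1)))) - 2 * \<delta> * (LA + LB)"
    and "\<delta> > 0" and "4 * (\<delta> * LB) \<le> \<Delta>B"
proof -
  define D l L where "D = min \<Delta>A \<Delta>B" and "l = min lA lB" and "L = max LA LB"
  define \<kappa> N where "\<kappa> = (m - 1) / m" and "N = M / (M - 1)"
  define \<mu> where "\<mu> = Min {\<Delta>A / (8 * LA), \<Delta>B / (4 * LB), lA * \<Delta>B / (100 * max (LA\<^sup>2) (LB\<^sup>2))}"
  have LL: "LA > 0" "LB > 0" using pos le by auto
  have D: "0 < D" "D \<le> \<Delta>A" "D \<le> \<Delta>B" using pos by (auto simp: D_def)
  have l: "0 < l" "l \<le> lA" "l \<le> L" using pos le by (auto simp: l_def L_def)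
  have L: "0 < L" "LA \<le> L" "LB \<le> L" using LL by (auto simp: L_def)
  have L2: "max (LA\<^sup>2) (LB\<^sup>2) = L\<^sup>2"
    using LL by (auto simp: L_def max_def power2_le_iff_abs_le)
  have \<kappa>: "0 < \<kappa>" "\<kappa> \<le> 1" using mM by (simp_all add: \<kappa>_def)
  have N: "1 \<le> N" using mM by (simp add: N_def)
  have N\<kappa>: "N * \<kappa> \<le> 1" using mM by (simp add: N_def \<kappa>_def field_simps)
  have \<mu>: "\<mu> \<le> \<Delta>B / (4 * LB)" "\<mu> \<le> lA * \<Delta>B / (100 * L\<^sup>2)"
    by (simp_all add: \<mu>_def L2)
  have \<mu>_ge: "D * l / (100 * L\<^sup>2) \<le> \<mu>"
  proof -
    have "l / L \<le> 1" using l L by simp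
    then have "D * (l / L) \<le> D * 1" using D by (intro mult_left_mono) auto
    then have c: "D * l / (100 * L\<^sup>2) \<le> D / (100 * L)"
      using L by (simp add: power2_eq_square field_simps)
    have "D / (100 * L) \<le> \<Delta>A / (8 * LA)" "D / (100 * L) \<le> \<Delta>B / (4 * LB)"
      using D L LL by (intro frac_le; simp)+
    moreover have "D * l / (100 * L\<^sup>2) \<le> lA * \<Delta>B / (100 * L\<^sup>2)"
      using D l mult_mono[of D \<Delta>B l lA] by (intro divide_right_mono) (auto simp: mult.commute)
    ultimately show ?thesis using c by (simp add: \<mu>_def L2)
  qed
  have "0 < D * l / (100 * L\<^sup>2)" using D l L by simp
  then have \<mu>_pos: "\<mu> > 0" using \<mu>_ge by simp
  have \<delta>: "\<delta> = \<kappa> * \<mu>" by (simp add: \<delta>_def \<kappa>_def \<mu>_def)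
  show \<delta>_pos: "\<delta> > 0" using \<delta> \<kappa> \<mu>_pos by simp
  have "\<delta> \<le> 1 * \<mu>" unfolding \<delta> using \<kappa> \<mu>_pos by (intro mult_right_mono) auto
  then have "\<delta> \<le> \<Delta>B / (4 * LB)" using \<mu>(1) by simp
  then show "4 * (\<delta> * LB) \<le> \<Delta>B" using LL by (simp add: field_simps)
  have T: "T = 1 / 10 * sqrt (N * \<kappa>) * (D * l / L)"
    by (simp add: T_def N_def \<kappa>_def D_def l_def L_def mult.commute)
  have "D * (l / L) \<le> D * 1" using D l L by (intro mult_left_mono) auto
  moreover have "1 / 10 * sqrt (N * \<kappa>) * (D * l / L) \<le> 1 * (D * l / L)"
  proof (rule mult_right_mono)
    have "sqrt (N * \<kappa>) \<le> 1" using N\<kappa> by simp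
    then show "1 / 10 * sqrt (N * \<kappa>) \<le> 1" by linarith
  qed (use D l L in simp)
  ultimately show "T \<le> min \<Delta>A \<Delta>B" unfolding T D_def[symmetric] by simp
  define Q where "Q = \<delta> * lA * \<Delta>B * N"
  have "T \<le> sqrt Q"
  proof (rule real_le_rsqrt)
    have "T\<^sup>2 = N * \<kappa> * ((D * l / (100 * L\<^sup>2)) * (l * D))"
      unfolding T using N \<kappa> L by (simp add: power_mult_distrib power_divide power2_eq_square)
    also have "\<dots> \<le> N * \<kappa> * (\<mu> * (lA * \<Delta>B))"
      using \<mu>_ge \<mu>_pos D l L N \<kappa> by (intro mult_left_mono mult_mono) auto
    also have "\<dots> = Q" by (simp add: Q_def \<delta>)
    finally show "T\<^sup>2 \<le> Q" .
  qed
  moreover have "10 * \<delta> * L \<le> sqrt Q"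
  proof (rule real_le_rsqrt)
    have "100 * L\<^sup>2 * \<mu> \<le> lA * \<Delta>B" using \<mu>(2) L by (simp add: field_simps)
    then have "\<delta> * \<kappa> * (100 * L\<^sup>2 * \<mu>) \<le> \<delta> * \<kappa> * (lA * \<Delta>B)"
      using \<delta>_pos \<kappa> by (intro mult_left_mono) auto
    also have "\<dots> \<le> \<delta> * N * (lA * \<Delta>B)"
      using \<delta>_pos \<kappa> N pos by (intro mult_right_mono mult_left_mono) auto
    finally show "(10 * \<delta> * L)\<^sup>2 \<le> Q"
      by (simp add: Q_def \<delta> power2_eq_square mult_ac)
  qed
  moreover have "\<delta> * (LA + LB) \<le> \<delta> * (2 * L)" using \<delta>_pos L by (intro mult_left_mono) auto
  moreover have "1.4 * sqrt Q \<le> sqrt (2 * Q)"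
  proof -
    have "1.4 \<le> sqrt (2 :: real)" by (rule real_le_rsqrt) (simp add: power2_eq_square)
    moreover have "0 \<le> sqrt Q" using N \<delta>_pos pos by (simp add: Q_def)
    ultimately have "1.4 * sqrt Q \<le> sqrt 2 * sqrt Q" by (rule mult_right_mono)
    then show ?thesis by (simp only: real_sqrt_mult)
  qed
  ultimately have "T \<le> sqrt (2 * Q) - 2 * \<delta> * (LA + LB)" by (simp add: mult.assoc)
  then show "T \<le> sqrt (2 * (\<delta> * lA * \<Delta>B * (M / (M - 1)))) - 2 * \<delta> * (LA + LB)"
    by (simp add: Q_def N_def)
qed

lemma p_elliptic_AE:
  fixes A :: "real^'n \<Rightarrow> complex^'n^'n"
  assumes "p_elliptic p A"
  shows "AE x in lebesgue. (\<forall>\<xi> \<omega>. \<bar>(A x *v \<xi>) \<bullet> \<omega>\<bar> \<le> Lambda_real A * norm \<xi> * norm \<omega>)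
      \<and> (\<forall>\<xi>. lambda_real A * (norm \<xi>)\<^sup>2 \<le> (A x *v \<xi>) \<bullet> \<xi>)
      \<and> (\<forall>\<xi>. Delta_real p A * (norm \<xi>)\<^sup>2
            \<le> (A x *v \<xi>) \<bullet> (\<xi> + \<bar>1 - 2 / p\<bar> *\<^sub>R vec_cnj \<xi>))"
    and "lambda_real A > 0" and "Delta_real p A > 0"
proof -
  have fin: "Lambda_ess A < \<infinity>" and pos: "lambda_ess A > 0" "Delta_ess p A > 0"
    using assms by (auto simp: p_elliptic_def elliptic_def)
  show "lambda_real A > 0" "Delta_real p A > 0"
    using essinf_real_le_AE(2)[OF pos(1)[unfolded lambda_ess_def]]
      essinf_real_le_AE(2)[OF pos(2)[unfolded Delta_ess_def]]
    by (simp_all add: lambda_ess_def Delta_ess_def)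
  show "AE x in lebesgue. (\<forall>\<xi> \<omega>. \<bar>(A x *v \<xi>) \<bullet> \<omega>\<bar> \<le> Lambda_real A * norm \<xi> * norm \<omega>)
      \<and> (\<forall>\<xi>. lambda_real A * (norm \<xi>)\<^sup>2 \<le> (A x *v \<xi>) \<bullet> \<xi>)
      \<and> (\<forall>\<xi>. Delta_real p A * (norm \<xi>)\<^sup>2
            \<le> (A x *v \<xi>) \<bullet> (\<xi> + \<bar>1 - 2 / p\<bar> *\<^sub>R vec_cnj \<xi>))"
    using AE_le_esssup_real[OF fin[unfolded Lambda_ess_def], folded Lambda_ess_def]
      essinf_real_le_AE(1)[OF pos(1)[unfolded lambda_ess_def], folded lambda_ess_def]
      essinf_real_le_AE(1)[OF pos(2)[unfolded Delta_ess_def], folded Delta_ess_def]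
  proof eventually_elim
    case (elim x)
    show ?case
      using abs_inner_le_of_SUP[OF elim(1)] twisted_form_ge_of_INF[OF elim(3)]
        twisted_form_ge_of_INF[of "lambda_real A" "A x" 0] elim(2)
      by simp
  qed
qed

theorem lemma6:
  fixes \<Phi> \<Psi> :: "real \<Rightarrow> real"
    and A B :: "real^'n \<Rightarrow> complex^'n^'n"
    and p :: real
  assumes "admissible_pair \<Phi> \<Psi>"
    and "p = M_tilde \<Phi> + 1"
    and "Linf_matrix A" and "Linf_matrix B"
    and "p_elliptic p A" and "p_elliptic p B"
  shows "AE x in lebesgue. \<forall>u v. u \<noteq> 0 \<and> v \<noteq> 0 \<and> (u, v) \<notin> Y_eq \<Phi> \<longrightarrow>
    (\<forall>\<zeta> \<eta>. gen_hessian (A x) (B x) (bellman \<Phi> \<Psi> A B) u v \<zeta> \<eta> \<ge>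
      1 / 10 * sqrt (M_tilde \<Phi> / m_tilde \<Phi> * ((m_tilde \<Phi> - 1) / (M_tilde \<Phi> - 1))) *
      inverse (C_const p A B) * norm \<zeta> * norm \<eta>)"
  using p_elliptic_AE(1)[OF assms(5)] p_elliptic_AE(1)[OF assms(6)]
proof eventually_elim
  case (elim x)
  interpret admissible \<Phi> \<Psi> by unfold_locales (rule assms(1))
  note pA = p_elliptic_AE(2,3)[OF assms(5)] and pB = p_elliptic_AE(2,3)[OF assms(6)]
  have le: "lambda_real C \<le> Lambda_real C"
    if "\<forall>\<xi> \<omega>. \<bar>(C x *v \<xi>) \<bullet> \<omega>\<bar> \<le> Lambda_real C * norm \<xi> * norm \<omega>"
      "\<forall>\<xi>. lambda_real C * (norm \<xi>)\<^sup>2 \<le> (C x *v \<xi>) \<bullet> \<xi>" for C :: "real^'n \<Rightarrow> complex^'n^'n"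
  proof -
    define e :: "complex^'n" where "e = axis undefined 1"
    have "norm e = 1" by (simp add: e_def)
    then show ?thesis using that(1)[rule_format, of e e] that(2)[rule_format, of e] by simp
  qed
  have leA: "lambda_real A \<le> Lambda_real A" and leB: "lambda_real B \<le> Lambda_real B"
    using le elim by blast+
  have LL: "Lambda_real A \<ge> 0" "Lambda_real B \<ge> 0" using pA pB leA leB by auto
  define \<delta> where "\<delta> = bellman_delta \<Phi> A B"
  define T where "T = 1 / 10 * sqrt (M / m * ((m - 1) / (M - 1))) * inverse (C_const p A B)"
  note bounds = bellman_constant_bounds[OF pA(2) pB(2) pA(1) pB(1) leA leB m_gt_1 m_le_M]
  have \<delta>_eq: "\<delta> = (m - 1) / m * Min {Delta_real p A / (8 * Lambda_real A),
      Delta_real p B / (4 * Lambda_real B),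
      lambda_real A * Delta_real p B / (100 * max ((Lambda_real A)\<^sup>2) ((Lambda_real B)\<^sup>2))}"
    by (simp add: \<delta>_def bellman_delta_def assms(2) Let_def)
  have T: "T \<le> min (Delta_real p A) (Delta_real p B)"
    "T \<le> sqrt (2 * (\<delta> * lambda_real A * Delta_real p B * (M / (M - 1))))
      - 2 * \<delta> * (Lambda_real A + Lambda_real B)"
    and \<delta>: "\<delta> > 0" "4 * (\<delta> * Lambda_real B) \<le> Delta_real p B"
    using bounds unfolding \<delta>_eq[symmetric] by (simp_all add: T_def C_const_def)
  show ?case
  proof (intro allI impI)
    fix u v \<zeta> \<eta> assume uv: "u \<noteq> 0 \<and> v \<noteq> 0 \<and> (u, v) \<notin> Y_eq \<Phi>"
    let ?H = "gen_hessian (A x) (B x) (bellman \<Phi> \<Psi> A B) u v \<zeta> \<eta>"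
    have "cmod v \<noteq> \<phi> (cmod u)" using uv by (simp add: Y_eq_def)
    then consider "cmod v < \<phi> (cmod u)" | "\<phi> (cmod u) < cmod v" by linarith
    then have "T * norm \<zeta> * norm \<eta> \<le> ?H"
    proof cases
      case 1
      define D where "D = min (Delta_real p A) (Delta_real p B)"
      have "D * (norm \<xi>)\<^sup>2 \<le> (A x *v \<xi>) \<bullet> (\<xi> + \<bar>1 - 2 / (M + 1)\<bar> *\<^sub>R vec_cnj \<xi>)"
        and "D * (norm \<xi>)\<^sup>2 \<le> (B x *v \<xi>) \<bullet> (\<xi> + \<bar>1 - 2 / (M + 1)\<bar> *\<^sub>R vec_cnj \<xi>)" for \<xi>
      proof -
        have "D * (norm \<xi>)\<^sup>2 \<le> Delta_real p A * (norm \<xi>)\<^sup>2" "D * (norm \<xi>)\<^sup>2 \<le> Delta_real p B * (norm \<xi>)\<^sup>2"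
          by (intro mult_right_mono; simp add: D_def)+
        then show "D * (norm \<xi>)\<^sup>2 \<le> (A x *v \<xi>) \<bullet> (\<xi> + \<bar>1 - 2 / (M + 1)\<bar> *\<^sub>R vec_cnj \<xi>)"
          and "D * (norm \<xi>)\<^sup>2 \<le> (B x *v \<xi>) \<bullet> (\<xi> + \<bar>1 - 2 / (M + 1)\<bar> *\<^sub>R vec_cnj \<xi>)"
          using elim unfolding assms(2) by (meson order_trans)+
      qed
      then have "D * norm \<zeta> * norm \<eta> \<le> ?H"
        using uv 1 \<delta> pA pB
        by (intro gen_hessian_lower_bound_below[where \<delta> = \<delta>])
          (auto simp: D_def bellman_def Let_def Y_down_def \<delta>_def)
      moreover have "T * norm \<zeta> * norm \<eta> \<le> D * norm \<zeta> * norm \<eta>"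
        using T(1) by (intro mult_right_mono) (auto simp: D_def)
      ultimately show ?thesis by linarith
    next
      case 2
      have "(sqrt (2 * (\<delta> * lambda_real A * Delta_real p B * (M / (M - 1))))
          - 2 * \<delta> * (Lambda_real A + Lambda_real B)) * norm \<zeta> * norm \<eta> \<le> ?H"
      proof (rule gen_hessian_lower_bound_above)
        show "Delta_real p A * (norm \<xi>)\<^sup>2 \<le> (A x *v \<xi>) \<bullet> (\<xi> + \<bar>1 - 2 / (M + 1)\<bar> *\<^sub>R vec_cnj \<xi>)"
          and "Delta_real p B * (norm \<xi>)\<^sup>2 \<le> (B x *v \<xi>) \<bullet> (\<xi> + \<bar>1 - 2 / (M + 1)\<bar> *\<^sub>R vec_cnj \<xi>)" for \<xi>
          using elim unfolding assms(2) by blast+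
        show "bellman \<Phi> \<Psi> A B x y = \<Phi> (cmod x) + \<Psi> (cmod y)
            + \<delta> * (cmod x)\<^sup>2 * integral {0..cmod y} (\<lambda>s. 1 / \<psi> s)" if "\<phi> (cmod x) < cmod y" for x y
          using that by (simp add: bellman_def Let_def Y_down_def Y_eq_def \<delta>_def)
      qed (use uv 2 \<delta> pA pB LL elim in auto)
      moreover have "T * norm \<zeta> * norm \<eta> \<le> (sqrt (2 * (\<delta> * lambda_real A * Delta_real p B * (M / (M - 1))))
          - 2 * \<delta> * (Lambda_real A + Lambda_real B)) * norm \<zeta> * norm \<eta>"
        using T(2) by (intro mult_right_mono) auto
      ultimately show ?thesis by linarith
    qed
    then show "1 / 10 * sqrt (M / m * ((m - 1) / (M - 1))) * inverse (C_const p A B)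
        * norm \<zeta> * norm \<eta> \<le> ?H"
      by (simp add: T_def)
  qed
qed

end
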